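(* Let $T:X\to X$ be a homeomorphism of a compact metric space $(X,d)$ with the specification property, let $\tau:X\to(0,\infty)$ be a continuous roof function, and let $(X_\tau,\Theta)$ be the corresponding suspension flow. Let $\Phi,H\in C(X_\tau)$ with $\inf_{\nu\in\mathcal{M}_\Theta}\int\Phi\,d\nu<\sup_{\nu\in\mathcal{M}_\Theta}\int\Phi\,d\nu$. Then $$\sup\Big\{\int H\,d\nu:\nu\in\mathcal{M}_\Theta\Big\}=\sup\Big\{\int H\,d\nu:\nu\in\bigcup_{(x,s)\in\widehat{X}_\Phi}\mathcal{V}((x,s))\Big\}=\sup_{(x,s)\in\widehat{X}_\Phi}\limsup_{t\to\infty}\frac1t\int_0^t H(\theta_u(x,s))\,du.$$
   Context: $(X,T)$ has the specification property if for every $\epsilon>0$ there is an integer $m(\epsilon)$ such that for any finite collection of intervals $[a_j,b_j]\subset\mathbb{N}$, $j=1,\dots,k$, with $a_{j+1}-b_j\ge m(\epsilon)$ for $j=1,\dots,k-1$, and any $x_1,\dots,x_k\in X$, there is $x\in X$ with $d(T^{p+a_j}x,T^px_j)<\epsilon$ for all $p=0,\dots,b_j-a_j$ and all $j$. The suspension space is $X_\tau=\{(x,s)\in X\times\mathbb{R}:0\le s\le\tau(x)\}$ with $(x,\tau(x))$ identified with $(Tx,0)$, equipped with the Bowen–Walters metric (making it compact); the suspension flow is $\theta_t(x,s)=(x,s+t)$ (with the identification). $\mathcal{M}_\Theta$ is the set of Borel probability measures on $X_\tau$ invariant under all $\theta_t$, $t\ge0$. $\widehat{X}_\Phi=\{(x,s)\in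 X_\tau:\lim_{t\to\infty}\frac1t\int_0^t\Phi(\theta_u(x,s))\,du\text{ does not exist}\}$. For $(x,s)\in X_\tau$, $\mathcal{V}((x,s))$ is the set of weak$^*$ limit points as $t\to\infty$ of $\delta_{(x,s),t}=\frac1t\int_0^t\delta_{\theta_u(x,s)}\,du$. *)

theory Defs
  imports "HOL-Analysis.Analysis" "HOL-Probability.Probability"
begin

definition has_specification :: "'a::metric_space set \<Rightarrow> ('a \<Rightarrow> 'a) \<Rightarrow> bool" where
  "has_specification X T \<longleftrightarrow>
     (\<forall>\<epsilon>>0. \<exists>m::nat. \<forall>(k::nat) (a::nat \<Rightarrow> nat) (b::nat \<Rightarrow> nat) (xs::nat \<Rightarrow> 'a).
        (\<forall>j<k. a j \<le> b j \<and> xs j \<in> X) \<and> (\<forall>j. Suc j < k \<longrightarrow> b j + m \<le> a (Suc j))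
        \<longrightarrow> (\<exists>x\<in>X. \<forall>j<k. \<forall>p\<le>b j - a j.
                dist ((T ^^ (p + a j)) x) ((T ^^ p) (xs j)) < \<epsilon>))"

text \<open>Points of the suspension space are represented by the canonical representatives
  (x,s) with x in X and 0 <= s < tau x; the point (x, tau x) is identified with (T x, 0).\<close>

definition susp_space :: "'a set \<Rightarrow> ('a \<Rightarrow> real) \<Rightarrow> ('a \<times> real) set" where
  "susp_space X \<tau> = {(x, s). x \<in> X \<and> 0 \<le> s \<and> s < \<tau> x}"

definition susp_closed :: "'a set \<Rightarrow> ('a \<Rightarrow> real) \<Rightarrow> ('a \<times> real) set" where
  "susp_closed X \<tau> = {(x, s). x \<in> X \<and> 0 \<le> s \<and> s \<le> \<tau> x}"

definition susp_proj :: "('a \<Rightarrow> 'a) \<Rightarrow> ('a \<Rightarrow> real) \<Rightarrow> 'a \<times> real \<Rightarrow> 'a \<times> real" where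
  "susp_proj T \<tau> p = (if snd p = \<tau> (fst p) then (T (fst p), 0) else p)"

text \<open>Quotient topology on the suspension space (this is the topology induced by the
  Bowen--Walters metric).\<close>
definition susp_top :: "'a::metric_space set \<Rightarrow> ('a \<Rightarrow> 'a) \<Rightarrow> ('a \<Rightarrow> real) \<Rightarrow> ('a \<times> real) topology" where
  "susp_top X T \<tau> = topology (\<lambda>U. U \<subseteq> susp_space X \<tau> \<and>
      openin (top_of_set (susp_closed X \<tau>)) {p \<in> susp_closed X \<tau>. susp_proj T \<tau> p \<in> U})"

definition roof_sum :: "('a \<Rightarrow> 'a) \<Rightarrow> ('a \<Rightarrow> real) \<Rightarrow> nat \<Rightarrow> 'a \<Rightarrow> real" where
  "roof_sum T \<tau> n x = (\<Sum>k<n. \<tau> ((T ^^ k) x))"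

text \<open>The suspension flow theta_t(x,s) = (x, s+t) modulo the identification (t >= 0).\<close>
definition susp_flow :: "('a \<Rightarrow> 'a) \<Rightarrow> ('a \<Rightarrow> real) \<Rightarrow> real \<Rightarrow> 'a \<times> real \<Rightarrow> 'a \<times> real" where
  "susp_flow T \<tau> t p =
     (let x = fst p; s = snd p; n = (LEAST n. s + t < roof_sum T \<tau> (Suc n) x)
      in ((T ^^ n) x, s + t - roof_sum T \<tau> n x))"

definition susp_borel :: "'a::metric_space set \<Rightarrow> ('a \<Rightarrow> 'a) \<Rightarrow> ('a \<Rightarrow> real) \<Rightarrow> ('a \<times> real) measure" where
  "susp_borel X T \<tau> = sigma (topspace (susp_top X T \<tau>)) {U. openin (susp_top X T \<tau>) U}"

definition susp_prob_measures :: "'a::metric_space set \<Rightarrow> ('a \<Rightarrow> 'a) \<Rightarrow> ('a \<Rightarrow> real) \<Rightarrow> ('a \<times> real) measure set" where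
  "susp_prob_measures X T \<tau> = {\<nu>. prob_space \<nu> \<and> sets \<nu> = sets (susp_borel X T \<tau>)}"

definition susp_inv_measures :: "'a::metric_space set \<Rightarrow> ('a \<Rightarrow> 'a) \<Rightarrow> ('a \<Rightarrow> real) \<Rightarrow> ('a \<times> real) measure set" where
  "susp_inv_measures X T \<tau> = {\<nu> \<in> susp_prob_measures X T \<tau>.
      \<forall>t\<ge>0. susp_flow T \<tau> t \<in> \<nu> \<rightarrow>\<^sub>M \<nu> \<and> distr \<nu> \<nu> (susp_flow T \<tau> t) = \<nu>}"

definition susp_avg :: "('a \<Rightarrow> 'a) \<Rightarrow> ('a \<Rightarrow> real) \<Rightarrow> ('a \<times> real \<Rightarrow> real) \<Rightarrow> 'a \<times> real \<Rightarrow> real \<Rightarrow> real" where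
  "susp_avg T \<tau> f p t = (1 / t) * integral {0..t} (\<lambda>u. f (susp_flow T \<tau> u p))"

definition susp_irregular :: "'a::metric_space set \<Rightarrow> ('a \<Rightarrow> 'a) \<Rightarrow> ('a \<Rightarrow> real) \<Rightarrow> ('a \<times> real \<Rightarrow> real) \<Rightarrow> ('a \<times> real) set" where
  "susp_irregular X T \<tau> \<Phi> = {p \<in> susp_space X \<tau>.
      \<not> (\<exists>L. (susp_avg T \<tau> \<Phi> p \<longlongrightarrow> L) at_top)}"

text \<open>V(p): weak* limit points (as t -> infinity) of the empirical measures delta_{p,t},
  i.e. cluster points of the net t |-> delta_{p,t} in the weak* topology, whose basic
  neighbourhoods are given by finitely many continuous functions and eps > 0.\<close>
definition susp_V :: "'a::metric_space set \<Rightarrow> ('a \<Rightarrow> 'a) \<Rightarrow> ('a \<Rightarrow> real) \<Rightarrow> 'a \<times> real \<Rightarrow> ('a \<times> real) measure set" where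
  "susp_V X T \<tau> p = {\<nu> \<in> susp_prob_measures X T \<tau>.
      \<forall>F. finite F \<and> (\<forall>f\<in>F. continuous_map (susp_top X T \<tau>) euclideanreal f) \<longrightarrow>
        (\<forall>\<epsilon>>0. \<forall>t0. \<exists>t\<ge>t0. \<forall>f\<in>F. \<bar>susp_avg T \<tau> f p t - integral\<^sup>L \<nu> f\<bar> < \<epsilon>)}"

lemma istopology_susp_top:
  "istopology (\<lambda>U. U \<subseteq> susp_space X \<tau> \<and>
      openin (top_of_set (susp_closed X \<tau>)) {p \<in> susp_closed X \<tau>. susp_proj T \<tau> p \<in> U})"
proof -
  let ?Y = "susp_closed X \<tau>" and ?f = "susp_proj T \<tau>"
  have i: "openin (top_of_set ?Y) {p \<in> ?Y. ?f p \<in> S \<inter> R}"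
    if "openin (top_of_set ?Y) {p \<in> ?Y. ?f p \<in> S}" "openin (top_of_set ?Y) {p \<in> ?Y. ?f p \<in> R}" for S R
  proof -
    have "{p \<in> ?Y. ?f p \<in> S \<inter> R} = {p \<in> ?Y. ?f p \<in> S} \<inter> {p \<in> ?Y. ?f p \<in> R}" by auto
    then show ?thesis using that by (simp add: openin_Int)
  qed
  have u: "openin (top_of_set ?Y) {p \<in> ?Y. ?f p \<in> \<Union>K}"
    if "\<forall>S\<in>K. openin (top_of_set ?Y) {p \<in> ?Y. ?f p \<in> S}" for K
  proof -
    have "{p \<in> ?Y. ?f p \<in> \<Union>K} = (\<Union>S\<in>K. {p \<in> ?Y. ?f p \<in> S})" by auto
    then show ?thesis using that by (auto intro!: openin_Union)
  qed
  show ?thesis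
    unfolding istopology_def
    using i u by blast
qed

end

theory Submission
  imports Defs
begin

text \<open>Every flow-invariant measure admits arbitrarily long orbit segments over the base on which the
  average of a given continuous function is almost as large as its integral: average over the times
  0, \<delta>, 2\<delta>, ... and pick a good starting point, so no ergodic theorem is needed. Apply this to H and
  a given invariant measure, and to \<Phi> and -\<Phi> and two measures with different \<Phi>-integrals.
  Specification and compactness produce one point whose orbit shadows such segments cyclically, each
  segment so long that everything before it is negligible. The averages of \<Phi> then oscillate, while
  those of H come close to the prescribed integral infinitely often; so the supremum over invariant
  measures is at most the one over orbit averages. Conversely, a cluster point of the orbit averages
  as functionals (Tychonoff) is represented by a measure (Riesz), and all such limit measures are
  invariant.\<close>

section \<open>The Riesz representation theorem on a compact space\<close>

text \<open>Specification concerns the base map, and a base point that shadows a segment need not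
  have the same return times, so flow times along the two orbits drift apart. The comparison is
  therefore moved to the base: f averages at least c over n laps from (x, 0) exactly when the
  Birkhoff sum of \<open>hat f x - c * \<tau> x\<close> over n steps is nonnegative, where
  \<open>hat f\<close> integrates f over one lap. Such sums change little per step under shadowing,
  whatever the elapsed flow time.

  The measure theory uses two facts about the suspension space: it is compact, and every open set is
  the positivity set of a continuous function. The second makes open sets measurable for the outer
  measure built from a functional, and makes measures determined by their integrals. Limits are
  taken on all continuous functions at once because the weak* neighbourhoods in
  \<open>susp_V\<close> involve arbitrary finite families.\<close>

locale positive_functional =
  fixes Y :: "'b topology" and L :: "('b \<Rightarrow> real) \<Rightarrow> real"
  assumes compact: "compact_space Y"
    and add: "continuous_map Y euclideanreal f \<Longrightarrow> continuous_map Y euclideanreal g \<Longrightarrow>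
               L (\<lambda>y. f y + g y) = L f + L g"
    and scale: "continuous_map Y euclideanreal f \<Longrightarrow> L (\<lambda>y. c * f y) = c * L f"
    and nonneg: "continuous_map Y euclideanreal f \<Longrightarrow> (\<And>y. y \<in> topspace Y \<Longrightarrow> 0 \<le> f y) \<Longrightarrow> 0 \<le> L f"
    and unit: "L (\<lambda>y. 1) = 1"
begin

abbreviation cts :: "('b \<Rightarrow> real) \<Rightarrow> bool"
  where "cts \<equiv> continuous_map Y euclideanreal"

definition cont_nonneg :: "('b \<Rightarrow> real) \<Rightarrow> bool"
  where "cont_nonneg f \<longleftrightarrow> cts f \<and> (\<forall>y\<in>topspace Y. 0 \<le> f y)"

lemma const: "L (\<lambda>y. c) = c"
  using scale[of "\<lambda>y. 1" c] unit by simp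

lemma diff: "cts f \<Longrightarrow> cts g \<Longrightarrow> L (\<lambda>y. f y - g y) = L f - L g"
  using add[of f "\<lambda>y. (-1) * g y"] scale[of g "-1"] by (simp add: continuous_map_real_mult_left)

lemma mono:
  assumes "cts f" "cts g" "\<And>y. y \<in> topspace Y \<Longrightarrow> f y \<le> g y"
  shows "L f \<le> L g"
  using nonneg[of "\<lambda>y. g y - f y"] diff[of g f] assms by (simp add: continuous_map_diff)

text \<open>\<open>L\<close> takes functions on the whole type, so functions that agree only on
  \<open>topspace Y\<close> are different arguments; positivity identifies their values.\<close>

lemma cong:
  assumes "cts f" "cts g" "\<And>y. y \<in> topspace Y \<Longrightarrow> f y = g y"
  shows "L f = L g"
  using assms by (intro antisym mono) auto

lemma sum:
  assumes "finite I" "\<And>i. i \<in> I \<Longrightarrow> cts (F i)"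
  shows "L (\<lambda>y. \<Sum>i\<in>I. F i y) = (\<Sum>i\<in>I. L (F i))"
  using assms
proof (induction I rule: finite_induct)
  case empty then show ?case using const[of 0] by simp
next
  case (insert x I)
  then show ?case
    using add[of "F x" "\<lambda>y. \<Sum>i\<in>I. F i y"] by (simp add: continuous_map_sum)
qed

text \<open>Countable families of nonnegative continuous functions take the place of open covers;
  \<open>outer\<close> is then the Daniell upper integral of the indicator of A.\<close>

definition covers :: "'b set \<Rightarrow> (nat \<Rightarrow> 'b \<Rightarrow> real) set" where
  "covers A = {F. (\<forall>i. cont_nonneg (F i)) \<and> (\<forall>y\<in>A. 1 \<le> (\<Sum>i. ennreal (F i y)))}"

definition outer :: "'b set \<Rightarrow> ennreal" where
  "outer A = (INF F\<in>covers A. \<Sum>i. ennreal (L (F i)))"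

lemma coversD: "F \<in> covers A \<Longrightarrow> y \<in> A \<Longrightarrow> 1 \<le> (\<Sum>i. ennreal (F i y))"
  by (simp add: covers_def)

lemma covers_const: "(\<lambda>i y. if i = 0 then 1 else 0) \<in> covers A"
proof -
  have "(\<Sum>i. ennreal (if i = 0 then 1 else 0)) = (1::ennreal)"
    by (subst suminf_finite[of "{0}"]) auto
  then show ?thesis
    by (auto simp: covers_def cont_nonneg_def if_distrib[of ennreal] cong: if_cong)
qed

text \<open>Finiteness of \<open>outer\<close> is what allows the choice of covers whose cost is
  strictly below \<open>outer A\<close> plus an error.\<close>

lemma outer_le_1: "outer A \<le> 1"
proof -
  have "outer A \<le> (\<Sum>i. ennreal (L ((\<lambda>i y. if i = 0 then 1 else 0) (i::nat))))"
    unfolding outer_def by (rule INF_lower[OF covers_const])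
  also have "\<dots> = 1"
    by (subst suminf_finite[of "{0}"]) (auto simp: const)
  finally show ?thesis .
qed

text \<open>This is the only use of compactness; it is Dini's theorem in disguise.\<close>
lemma le_suminf:
  assumes g: "cts g" and F: "\<And>i. cont_nonneg (F i)"
    and le: "\<And>y. y \<in> topspace Y \<Longrightarrow> ennreal (g y) \<le> (\<Sum>i. ennreal (F i y))"
  shows "ennreal (L g) \<le> (\<Sum>i. ennreal (L (F i)))"
proof (rule ennreal_le_epsilon)
  fix e :: real assume e: "0 < e"
  have cF: "cts (F i)" and nF: "y \<in> topspace Y \<Longrightarrow> 0 \<le> F i y" for i y
    using F by (auto simp: cont_nonneg_def)
  have nL: "0 \<le> L (F i)" for i by (intro nonneg cF nF)
  define W where "W n = {y\<in>topspace Y. (\<Sum>i<n. F i y) - g y \<in> {-e<..}}" for n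
  have oW: "openin Y (W n)" for n
    unfolding W_def
    by (rule openin_continuous_map_preimage[of _ euclideanreal]) 
       (auto intro!: continuous_intros continuous_map_diff continuous_map_sum cF g)
  have mW: "W m \<subseteq> W n" if "m \<le> n" for m n
  proof
    fix y assume y: "y \<in> W m"
    have "(\<Sum>i<m. F i y) \<le> (\<Sum>i<n. F i y)"
      using that y by (intro sum_mono2) (auto simp: W_def nF)
    then show "y \<in> W n" using y by (auto simp: W_def)
  qed
  have "topspace Y \<subseteq> \<Union>(range W)"
  proof
    fix y assume y: "y \<in> topspace Y"
    show "y \<in> \<Union>(range W)"
    \<comment> \<open>\<open>ennreal\<close> truncates at 0, so \<open>g y - e\<close> can be
      compared with the partial sums only when it is nonnegative; otherwise y already lies in
      \<open>W 0\<close>.\<close>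
    proof (cases "g y < e")
      case True
      then have "y \<in> W 0" using y by (simp add: W_def)
      then show ?thesis by blast
    next
      case False
      then have "ennreal (g y - e) < ennreal (g y)" using e by (simp add: ennreal_less_iff)
      also have "\<dots> \<le> (SUP n. \<Sum>i<n. ennreal (F i y))" using le[OF y] by (simp add: suminf_eq_SUP)
      finally obtain n where "ennreal (g y - e) < (\<Sum>i<n. ennreal (F i y))" by (auto simp: less_SUP_iff)
      also have "(\<Sum>i<n. ennreal (F i y)) = ennreal (\<Sum>i<n. F i y)" using nF[OF y] by simp
      finally have "g y - e < (\<Sum>i<n. F i y)"
        using False by (simp add: ennreal_less_iff)
      then have "y \<in> W n" using y by (simp add: W_def)
      then show ?thesis by blast
    qed
  qed
  then obtain \<F> where \<F>: "finite \<F>" "\<F> \<subseteq> range W" "topspace Y \<subseteq> \<Union>\<F>"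
    using compact oW unfolding compact_space_alt by (metis (no_types, lifting) imageE)
  then obtain N where N: "finite N" "\<F> = W ` N" by (metis finite_subset_image)
  obtain n where n: "\<And>m. m \<in> N \<Longrightarrow> m \<le> n" using Max_ge[OF N(1)] that by metis
  have "\<Union>\<F> \<subseteq> W n" using mW[OF n] unfolding N(2) by blast
  with \<F>(3) have W: "topspace Y \<subseteq> W n" by blast
  have "L g \<le> L (\<lambda>y. (\<Sum>i<n. F i y) + e)"
    using W by (intro mono g continuous_map_add continuous_map_sum cF) (auto simp: W_def)
  also have "\<dots> = (\<Sum>i<n. L (F i)) + e"
    using cF by (subst add) (auto simp: sum const intro!: continuous_map_sum)
  finally have "ennreal (L g) \<le> ennreal ((\<Sum>i<n. L (F i)) + e)" by (rule ennreal_leI)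
  also have "\<dots> = (\<Sum>i<n. ennreal (L (F i))) + ennreal e"
    using nL e by (simp add: sum_nonneg)
  also have "\<dots> \<le> (\<Sum>i. ennreal (L (F i))) + ennreal e"
    by (intro add_right_mono sum_le_suminf) auto
  finally show "ennreal (L g) \<le> (\<Sum>i. ennreal (L (F i))) + ennreal e" .
qed

text \<open>A cover of A dominates g everywhere: on A because g is at most 1 there, off A because
  \<open>ennreal (g y)\<close> is 0. So \<open>le_suminf\<close> bounds \<open>L g\<close> by the
  cost of every cover.\<close>

lemma le_outer:
  assumes g: "cts g" and A: "\<And>y. y \<in> topspace Y - A \<Longrightarrow> g y \<le> 0" "\<And>y. y \<in> A \<Longrightarrow> g y \<le> 1"
  shows "ennreal (L g) \<le> outer A"
  unfolding outer_def
proof (rule INF_greatest)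
  fix F assume F: "F \<in> covers A"
  show "ennreal (L g) \<le> (\<Sum>i. ennreal (L (F i)))"
  proof (rule le_suminf[OF g])
    fix y assume y: "y \<in> topspace Y"
    show "ennreal (g y) \<le> (\<Sum>i. ennreal (F i y))"
    proof (cases "y \<in> A")
      case True
      then have "ennreal (g y) \<le> 1" using A(2) by (metis ennreal_1 ennreal_leI)
      then show ?thesis using F True by (blast intro: order_trans dest: coversD)
    next
      case False
      then show ?thesis using A(1) y by (simp add: ennreal_neg)
    qed
  qed (use F in \<open>auto simp: covers_def\<close>)
qed

lemma outer_measure_space_outer: "outer_measure_space (Pow (topspace Y)) outer"
  unfolding outer_measure_space_def
proof (intro conjI)
  have "outer {} \<le> (\<Sum>i. ennreal (L ((\<lambda>i y. 0) (i::nat))))"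
    unfolding outer_def by (rule INF_lower) (simp add: covers_def cont_nonneg_def)
  then show "positive (Pow (topspace Y)) outer"
    by (simp add: positive_def const)
  show "increasing (Pow (topspace Y)) outer"
    unfolding increasing_def outer_def
    by (intro ballI impI INF_superset_mono) (auto simp: covers_def)
  show "countably_subadditive (Pow (topspace Y)) outer"
    unfolding countably_subadditive_def
  proof (intro allI impI)
    fix A :: "nat \<Rightarrow> 'b set"
    show "outer (\<Union>i. A i) \<le> (\<Sum>i. outer (A i))"
    proof (rule ennreal_le_epsilon)
      fix e :: real assume e: "0 < e"
      have "\<exists>F\<in>covers (A n). (\<Sum>i. ennreal (L (F i))) < outer (A n) + ennreal (e * (1/2)^Suc n)" for n
      proof -
        have "outer (A n) < outer (A n) + ennreal (e * (1/2)^Suc n)"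
          using e outer_le_1[of "A n"] by (auto simp: top_unique)
        then show ?thesis unfolding outer_def INF_less_iff by auto
      qed
      then obtain F where F: "F n \<in> covers (A n)"
        and FL: "(\<Sum>i. ennreal (L (F n i))) < outer (A n) + ennreal (e * (1/2)^Suc n)" for n
        by metis
      define G where "G k = F (fst (prod_decode k)) (snd (prod_decode k))" for k
      have "G \<in> covers (\<Union>i. A i)"
        unfolding covers_def
      proof (intro CollectI conjI allI ballI)
        show "cont_nonneg (G k)" for k
          using F[of "fst (prod_decode k)"] by (auto simp: G_def covers_def)
        fix y assume "y \<in> (\<Union>i. A i)"
        then obtain m where m: "y \<in> A m" by blast
        have "1 \<le> (\<Sum>i. ennreal (F m i y))" using F[of m] m by (auto simp: covers_def)
        also have "\<dots> \<le> (\<Sum>m. \<Sum>i. ennreal (F m i y))"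
          using sum_le_suminf[of "\<lambda>m. \<Sum>i. ennreal (F m i y)" "{m}"] by auto
        also have "\<dots> = (\<Sum>k. ennreal (G k y))"
          unfolding G_def
          using suminf_ennreal_2dimen[of "\<lambda>m. \<Sum>i. ennreal (F m i y)" "\<lambda>(m,i). ennreal (F m i y)"]
          by (simp add: case_prod_beta)
        finally show "1 \<le> (\<Sum>k. ennreal (G k y))" .
      qed
      then have "outer (\<Union>i. A i) \<le> (\<Sum>k. ennreal (L (G k)))"
        unfolding outer_def by (rule INF_lower)
      also have "\<dots> = (\<Sum>m. \<Sum>i. ennreal (L (F m i)))"
        unfolding G_def
        using suminf_ennreal_2dimen[of "\<lambda>m. \<Sum>i. ennreal (L (F m i))" "\<lambda>(m,i). ennreal (L (F m i))"]
        by (simp add: case_prod_beta)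
      also have "\<dots> \<le> (\<Sum>n. outer (A n) + ennreal (e * (1/2) ^ Suc n))"
        using FL by (intro suminf_le) (auto intro: less_imp_le)
      also have "\<dots> = (\<Sum>n. outer (A n)) + (\<Sum>n. ennreal e * ennreal ((1/2) ^ Suc n))"
        using e by (subst suminf_add[symmetric])
          (auto simp del: ennreal_suminf_cmult simp add: ennreal_mult[symmetric])
      also have "\<dots> = (\<Sum>n. outer (A n)) + ennreal e"
        unfolding ennreal_suminf_cmult
        by (subst suminf_ennreal_eq[OF zero_le_power power_half_series]) auto
      finally show "outer (\<Union>i. A i) \<le> (\<Sum>n. outer (A n)) + ennreal e" .
    qed
  qed
qed

text \<open>This is the nontrivial half of Caratheodory's condition for a cozero set U. The cut-offs
  min 1 (n h) increase to the indicator of U, so a cover of A can be multiplied by them to serve A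
  \<inter> U and by their complements to serve A - U.\<close>

lemma cozero_additive:
  assumes h: "cont_nonneg h" and U: "U = {y\<in>topspace Y. 0 < h y}" and A: "A \<subseteq> topspace Y"
  shows "outer (A \<inter> U) + outer (A - U) \<le> outer A"
  unfolding outer_def[of A]
proof (rule INF_greatest)
  fix F assume F: "F \<in> covers A"
  have cF: "cts (F i)" and nF: "y \<in> topspace Y \<Longrightarrow> 0 \<le> F i y" for i y
    using F by (auto simp: covers_def cont_nonneg_def)
  define \<phi> where "\<phi> n y = min 1 (real n * h y)" for n y
  have c\<phi>: "cts (\<phi> n)" for n
    using h unfolding \<phi>_def cont_nonneg_def
    by (intro continuous_map_real_min continuous_map_real_mult) auto
  have \<phi>m: "\<phi> m y \<le> \<phi> n y" if "m \<le> n" "y \<in> topspace Y" for m n y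
    using h that unfolding \<phi>_def cont_nonneg_def
    by (intro min.mono mult_right_mono) auto
  have \<phi>0: "0 \<le> \<phi> n y" "\<phi> n y \<le> 1" if "y \<in> topspace Y" for n y
    using h that by (auto simp: \<phi>_def cont_nonneg_def)
  have \<phi>z: "\<phi> 0 y = 0" for y by (simp add: \<phi>_def)
  define a where "a i n = L (\<lambda>y. F i y * \<phi> n y)" for i n
  have cG: "cts (\<lambda>y. F i y * \<phi> n y)" for i n
    by (intro continuous_map_real_mult cF c\<phi>)
  have a0: "0 \<le> a i n" for i n
    unfolding a_def by (intro nonneg cG mult_nonneg_nonneg nF \<phi>0)
  have am: "a i m \<le> a i n" if "m \<le> n" for i m n
    unfolding a_def by (intro mono cG mult_left_mono nF \<phi>m that)
  have az: "a i 0 = 0" for i by (simp add: a_def \<phi>z const)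
  \<comment> \<open>At a point of U the cut-off reaches 1 only after a number of steps depending on
    the point, so one fixed n need not give a cover of A \<inter> U. The increments in n do: they
    are nonnegative and add up to \<open>F i\<close> on U.\<close>
  define G where "G i n = (\<lambda>y. F i y * \<phi> (Suc n) y - F i y * \<phi> n y)" for i n
  have LG: "L (G i n) = a i (Suc n) - a i n" for i n
    unfolding G_def a_def by (intro diff cG)
  have nG: "cont_nonneg (G i n)" for i n
    unfolding G_def cont_nonneg_def
    using \<phi>m[of n "Suc n"] nF by (auto intro!: continuous_map_diff cG mult_left_mono)
  have tele: "(\<Sum>n<N. ennreal (b (Suc n) - b n)) = ennreal (b N - b 0)"
    if "\<And>n. b n \<le> b (Suc n)" for b :: "nat \<Rightarrow> real" and N
    using that by (simp add: sum_lessThan_telescope)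
  define G' where "G' k = G (fst (prod_decode k)) (snd (prod_decode k))" for k
  have "G' \<in> covers (A \<inter> U)"
    unfolding covers_def
  proof (intro CollectI conjI allI ballI)
    show "cont_nonneg (G' k)" for k by (simp add: G'_def nG)
    fix y assume y: "y \<in> A \<inter> U"
    then have yY: "y \<in> topspace Y" using A by blast
    obtain N where "1 < real N * h y" using y reals_Archimedean3[of "h y"] by (auto simp: U)
    then have \<phi>N: "\<phi> N y = 1" by (simp add: \<phi>_def)
    have *: "ennreal (F i y) \<le> (\<Sum>n. ennreal (G i n y))" for i
    proof -
      have "ennreal (F i y) = (\<Sum>n<N. ennreal (G i n y))"
        unfolding G_def using tele[of "\<lambda>n. F i y * \<phi> n y" N] \<phi>m[of _ "Suc _" y] nF[OF yY] yY
        by (simp add: \<phi>N \<phi>z mult_left_mono)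
      also have "\<dots> \<le> (\<Sum>n. ennreal (G i n y))" by (intro sum_le_suminf) auto
      finally show ?thesis .
    qed
    have "1 \<le> (\<Sum>i. ennreal (F i y))" using F y by (auto simp: covers_def)
    also have "\<dots> \<le> (\<Sum>i. \<Sum>n. ennreal (G i n y))" using * by (intro suminf_le) auto
    also have "\<dots> = (\<Sum>k. ennreal (G' k y))"
      unfolding G'_def
      using suminf_ennreal_2dimen[of "\<lambda>m. \<Sum>i. ennreal (G m i y)" "\<lambda>(m,i). ennreal (G m i y)"]
      by (simp add: case_prod_beta)
    finally show "1 \<le> (\<Sum>k. ennreal (G' k y))" .
  qed
  then have "outer (A \<inter> U) \<le> (\<Sum>k. ennreal (L (G' k)))"
    unfolding outer_def by (rule INF_lower)
  also have "\<dots> = (\<Sum>i. \<Sum>n. ennreal (L (G i n)))"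
    unfolding G'_def
    using suminf_ennreal_2dimen[of "\<lambda>m. \<Sum>i. ennreal (L (G m i))" "\<lambda>(m,i). ennreal (L (G m i))"]
    by (simp add: case_prod_beta)
  also have "\<dots> = (\<Sum>i. SUP N. ennreal (a i N))"
    unfolding LG suminf_eq_SUP[of "\<lambda>n. ennreal (a _ (Suc n) - a _ n)"]
    using tele[of "a _"] am[of _ "Suc _"] by (simp add: az)
  \<comment> \<open>Monotone convergence pulls the supremum out, so that each single N can be
    compared with the complementary piece.\<close>
  also have "\<dots> = (SUP N. \<Sum>i. ennreal (a i N))"
    using am by (intro ennreal_suminf_SUP_eq) (auto simp: incseq_def intro: ennreal_leI)
  finally have 1: "outer (A \<inter> U) \<le> (SUP N. \<Sum>i. ennreal (a i N))" .
  \<comment> \<open>Off U the cut-off vanishes, so for every N the remainders of the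
    \<open>F i\<close> still cover A - U.\<close>
  have 2: "(\<Sum>i. ennreal (a i N)) + outer (A - U) \<le> (\<Sum>i. ennreal (L (F i)))" for N
  proof -
    have c: "cts (\<lambda>y. F i y - F i y * \<phi> N y)" for i by (intro continuous_map_diff cG cF)
    have le: "F i y * \<phi> N y \<le> F i y" if "y \<in> topspace Y" for i y
      using nF[OF that] \<phi>0[OF that] by (simp add: mult_left_le)
    have "(\<lambda>i y. F i y - F i y * \<phi> N y) \<in> covers (A - U)"
      unfolding covers_def
    proof (intro CollectI conjI allI ballI)
      show "cont_nonneg (\<lambda>y. F i y - F i y * \<phi> N y)" for i
        using le by (auto simp: cont_nonneg_def c)
      fix y assume y: "y \<in> A - U"
      then have "h y = 0" using A h by (fastforce simp: U cont_nonneg_def)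
      then show "1 \<le> (\<Sum>i. ennreal (F i y - F i y * \<phi> N y))"
        using F y by (auto simp: covers_def \<phi>_def)
    qed
    then have "outer (A - U) \<le> (\<Sum>i. ennreal (L (\<lambda>y. F i y - F i y * \<phi> N y)))"
      unfolding outer_def by (rule INF_lower)
    then have "(\<Sum>i. ennreal (a i N)) + outer (A - U)
      \<le> (\<Sum>i. ennreal (a i N)) + (\<Sum>i. ennreal (L (F i) - a i N))"
      by (simp add: diff cF cG a_def add_left_mono)
    also have "\<dots> = (\<Sum>i. ennreal (a i N) + ennreal (L (F i) - a i N))"
      by (rule suminf_add) auto
    also have "\<dots> = (\<Sum>i. ennreal (L (F i)))"
    proof -
      have "a i N \<le> L (F i)" for i unfolding a_def by (intro mono cG cF le)
      then have "ennreal (a i N) + ennreal (L (F i) - a i N) = ennreal (L (F i))" for i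
        using a0 by (subst ennreal_plus[symmetric]) auto
      then show ?thesis by simp
    qed
    finally show ?thesis .
  qed
  have "outer (A \<inter> U) + outer (A - U) \<le> (SUP N. \<Sum>i. ennreal (a i N)) + outer (A - U)"
    by (intro add_right_mono 1)
  also have "\<dots> = (SUP N. (\<Sum>i. ennreal (a i N)) + outer (A - U))"
    by (subst ennreal_SUP_add_left) auto
  also have "\<dots> \<le> (\<Sum>i. ennreal (L (F i)))"
    by (intro SUP_least 2)
  finally show "outer (A \<inter> U) + outer (A - U) \<le> (\<Sum>i. ennreal (L (F i)))" .
qed

text \<open>The k-th summand is the part of x between the heights k and k + 1: a discrete layer-cake
  formula.\<close>

lemma sum_slices: "(\<Sum>k<N. min 1 (max 0 (x - real k))) = min (max 0 x) (real N)"
  by (induction N) (auto simp: min_def max_def)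

text \<open>The hypothesis \<open>cozero\<close> makes open sets Caratheodory measurable. The
  representation is first an inequality for functions with values in [0, 1]; applying it to 1 - f as
  well gives equality.\<close>

theorem exists_measure:
  assumes cozero: "\<And>U. openin Y U \<Longrightarrow> \<exists>h. cont_nonneg h \<and> U = {y\<in>topspace Y. 0 < h y}"
  shows "\<exists>\<nu>. prob_space \<nu> \<and> sets \<nu> = sets (sigma (topspace Y) {U. openin Y U}) \<and>
             (\<forall>f. cts f \<longrightarrow> integral\<^sup>L \<nu> f = L f)"
proof -
  let ?\<Omega> = "topspace Y" and ?O = "{U. openin Y U}"
  let ?\<Lambda> = "lambda_system ?\<Omega> (Pow ?\<Omega>) outer"
  interpret P: sigma_algebra ?\<Omega> "Pow ?\<Omega>" by (rule sigma_algebra_Pow)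
  note om = outer_measure_space_outer
  have ms: "measure_space ?\<Omega> ?\<Lambda> outer" by (rule P.caratheodory_lemma[OF om])
  have sub: "subadditive (Pow ?\<Omega>) outer"
    using om by (intro P.countably_subadditive_subadditive) (auto simp: outer_measure_space_def)
  have OP: "?O \<subseteq> Pow ?\<Omega>" by (auto dest: openin_subset)
  have "?O \<subseteq> ?\<Lambda>"
  proof
    fix U assume U: "U \<in> ?O"
    then obtain h where h: "cont_nonneg h" "U = {y\<in>topspace Y. 0 < h y}" using cozero by blast
    have "outer (A \<inter> U) + outer (A - U) = outer A" if "A \<subseteq> ?\<Omega>" for A
    proof (rule antisym[OF cozero_additive[OF h that]])
      have "outer ((A \<inter> U) \<union> (A - U)) \<le> outer (A \<inter> U) + outer (A - U)"
        using that by (intro subadditiveD[OF sub]) auto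
      then show "outer A \<le> outer (A \<inter> U) + outer (A - U)" by (simp add: Int_Diff_Un)
    qed
    then show "U \<in> ?\<Lambda>" using U OP by (auto simp: P.lambda_system_eq)
  qed
  then have "sigma_sets ?\<Omega> ?O \<subseteq> ?\<Lambda>"
    using ms by (intro sigma_algebra.sigma_sets_subset) (auto simp: measure_space_def)
  then have ms': "measure_space ?\<Omega> (sigma_sets ?\<Omega> ?O) outer"
    by (intro measure_down[OF ms] sigma_algebra_sigma_sets OP)
  define \<nu> where "\<nu> = measure_of ?\<Omega> ?O outer"
  have space: "space \<nu> = ?\<Omega>" and sets: "sets \<nu> = sigma_sets ?\<Omega> ?O"
    using OP by (auto simp: \<nu>_def)
  have em: "emeasure \<nu> A = outer A" if "A \<in> sigma_sets ?\<Omega> ?O" for A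
    using ms' that OP
    by (intro emeasure_measure_of[OF \<nu>_def]) (auto simp: measure_space_def sets)
  have Om: "?\<Omega> \<in> sigma_sets ?\<Omega> ?O" by (rule sigma_sets_top)
  have "outer ?\<Omega> = 1"
    using le_outer[of "\<lambda>y. 1" ?\<Omega>] outer_le_1[of ?\<Omega>] by (intro antisym) (auto simp: unit)
  then have prob: "prob_space \<nu>" by (intro prob_spaceI) (simp add: space em Om)
  interpret prob_space \<nu> by (rule prob)
  have open_sets: "openin Y U \<Longrightarrow> U \<in> sets \<nu>" for U by (auto simp: sets)
  have meas: "f \<in> borel_measurable \<nu>" if "cts f" for f
  proof (rule borel_measurableI)
    fix S :: "real set" assume "open S"
    then have "openin Y {y\<in>?\<Omega>. f y \<in> S}" using openin_continuous_map_preimage[OF that] by simp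
    moreover have "f -` S \<inter> space \<nu> = {y\<in>?\<Omega>. f y \<in> S}" by (auto simp: space)
    ultimately show "f -` S \<inter> space \<nu> \<in> sets \<nu>" using open_sets by simp
  qed
  have int: "integrable \<nu> f" if f: "cts f" "\<And>y. y \<in> ?\<Omega> \<Longrightarrow> \<bar>f y\<bar> \<le> B" for f B
    using that(2) by (intro integrable_const_bound[of _ B] meas f(1) AE_I2) (auto simp: space)
  \<comment> \<open>N f is cut into N slices \<open>S k\<close>, each at most 1 and vanishing off
    \<open>U k\<close>, so \<open>L (S k)\<close> is at most the measure of \<open>U k\<close>. The
    indicators of the \<open>U k\<close> add up to at most N f + 1, and division by N leaves an
    error 1/N.\<close>
  have le: "L f \<le> integral\<^sup>L \<nu> f" if f: "cts f" and f01: "\<And>y. y \<in> ?\<Omega> \<Longrightarrow> 0 \<le> f y \<and> f y \<le> 1" for f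
  proof (rule field_le_epsilon)
    fix e :: real assume "0 < e"
    then obtain n where n: "inverse (real (Suc n)) < e" using reals_Archimedean by blast
    define N where "N = Suc n"
    define U where "U k = {y\<in>?\<Omega>. real N * f y \<in> {real k<..}}" for k
    define S where "S k y = min 1 (max 0 (real N * f y - real k))" for k y
    have cS: "cts (S k)" for k
      unfolding S_def
      by (intro continuous_map_real_min continuous_map_real_max continuous_map_diff
          continuous_map_real_mult_left f) auto
    have U: "openin Y (U k)" for k
      unfolding U_def by (rule openin_continuous_map_preimage[of _ euclideanreal])
        (auto intro: continuous_map_real_mult_left f)
    have SU: "L (S k) \<le> measure \<nu> (U k)" for k
    proof -
      have "ennreal (L (S k)) \<le> outer (U k)"
        by (rule le_outer[OF cS]) (auto simp: S_def U_def)
      also have "\<dots> = ennreal (measure \<nu> (U k))"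
        using em[of "U k"] U[of k] by (simp add: emeasure_eq_measure)
      finally show ?thesis by (simp add: ennreal_le_iff)
    qed
    have "real N * L f = L (\<lambda>y. \<Sum>k<N. S k y)"
    proof -
      have "L (\<lambda>y. real N * f y) = L (\<lambda>y. \<Sum>k<N. S k y)"
        using f01 unfolding S_def sum_slices
        by (intro cong continuous_map_real_mult_left f continuous_map_real_min continuous_map_real_max)
          (auto simp: min_def max_def mult_left_le)
      then show ?thesis using scale[OF f] by simp
    qed
    also have "\<dots> = (\<Sum>k<N. L (S k))" by (intro sum cS) auto
    also have "\<dots> \<le> (\<Sum>k<N. measure \<nu> (U k))" by (intro sum_mono SU)
    also have "\<dots> = integral\<^sup>L \<nu> (\<lambda>y. \<Sum>k<N. indicator (U k) y)"
      using U by (subst Bochner_Integration.integral_sum) (auto simp: open_sets emeasure_eq_measure)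
    also have "\<dots> \<le> integral\<^sup>L \<nu> (\<lambda>y. real N * f y + 1)"
    proof (rule integral_mono)
      show "integrable \<nu> (\<lambda>y. \<Sum>k<N. indicator (U k) y :: real)"
        using U by (auto simp: open_sets emeasure_eq_measure)
      show "integrable \<nu> (\<lambda>y. real N * f y + 1)" using int[OF f, of 1] f01 by auto
      fix y assume "y \<in> space \<nu>"
      then have y: "0 \<le> f y" using f01 by (simp add: space)
      \<comment> \<open>On \<open>U k\<close> the slice of \<open>real N * f y + 1\<close> at height
        k is full, hence equal to 1.\<close>
      have "(\<Sum>k<N. indicator (U k) y) \<le> (\<Sum>k<N. min 1 (max 0 ((real N * f y + 1) - real k)))"
        by (intro sum_mono) (auto simp: U_def indicator_def)
      also have "\<dots> \<le> real N * f y + 1" unfolding sum_slices using y by auto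
      finally show "(\<Sum>k<N. indicator (U k) y) \<le> real N * f y + 1" .
    qed
    also have "\<dots> = real N * integral\<^sup>L \<nu> f + 1"
      using int[OF f, of 1] f01 by (subst Bochner_Integration.integral_add) (auto simp: prob_space)
    finally have "L f \<le> integral\<^sup>L \<nu> f + inverse (real N)"
      by (simp add: N_def field_simps)
    then show "L f \<le> integral\<^sup>L \<nu> f + e" using n by (simp add: N_def)
  qed
  have eq01: "integral\<^sup>L \<nu> f = L f" if f: "cts f" and f01: "\<And>y. y \<in> ?\<Omega> \<Longrightarrow> 0 \<le> f y \<and> f y \<le> 1" for f
  proof -
    have "L (\<lambda>y. 1 - f y) \<le> integral\<^sup>L \<nu> (\<lambda>y. 1 - f y)"
      using f01 by (intro le continuous_map_diff f) auto
    then have "1 - L f \<le> 1 - integral\<^sup>L \<nu> f"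
      using int[OF f, of 1] f01 by (simp add: diff f unit prob_space)
    then show ?thesis using le[OF f f01] by simp
  qed
  have "integral\<^sup>L \<nu> f = L f" if f: "cts f" for f
  proof -
    have "compact (f ` ?\<Omega>)"
      using image_compactin[of Y ?\<Omega> euclideanreal f] compact f by (simp add: compact_space_def)
    then obtain B where B: "B > 0" "\<And>y. y \<in> ?\<Omega> \<Longrightarrow> \<bar>f y\<bar> \<le> B"
      using bounded_pos by (metis compact_imp_bounded imageI real_norm_def)
    define g where "g y = (1 / (2 * B)) * (f y + B)" for y
    have g: "cts g" unfolding g_def
      by (intro continuous_map_real_mult_left continuous_map_add f) auto
    have "0 \<le> g y \<and> g y \<le> 1" if "y \<in> ?\<Omega>" for y
      using B(1) B(2)[OF that] by (simp add: g_def abs_le_iff field_simps)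
    then have eq: "integral\<^sup>L \<nu> g = L g" by (intro eq01 g)
    have "L g = (1 / (2 * B)) * (L f + B)"
      unfolding g_def by (subst scale) (auto simp: add f const continuous_map_add)
    moreover have "integral\<^sup>L \<nu> g = (1 / (2 * B)) * (integral\<^sup>L \<nu> f + B)"
      unfolding g_def using int[OF f B(2)] by (simp add: prob_space)
    ultimately show ?thesis using eq B(1) by simp
  qed
  then show ?thesis
    using prob OP by (intro exI[of _ \<nu>]) (simp add: sets)
qed

end

section \<open>The suspension space and its flow\<close>

lemma roof_sum_0 [simp]: "roof_sum T \<tau> 0 x = 0"
  by (simp add: roof_sum_def)

lemma roof_sum_Suc: "roof_sum T \<tau> (Suc n) x = roof_sum T \<tau> n x + \<tau> ((T ^^ n) x)"
  by (simp add: roof_sum_def)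

lemma roof_sum_add: "roof_sum T \<tau> (m + n) x = roof_sum T \<tau> m x + roof_sum T \<tau> n ((T ^^ m) x)"
  by (induction n) (simp_all add: roof_sum_Suc funpow_add add.commute[of m])

text \<open>The inverse g is a parameter because the point of the closed region identified with (x,
  0) is (g x, \<tau> (g x)).\<close>

locale suspension =
  fixes X :: "'a::metric_space set" and T g :: "'a \<Rightarrow> 'a" and \<tau> :: "'a \<Rightarrow> real"
  assumes compact: "compact X"
    and homeo: "homeomorphism X X T g"
    and cont_roof: "continuous_on X \<tau>"
    and roof_pos: "x \<in> X \<Longrightarrow> 0 < \<tau> x"
begin

abbreviation "Y \<equiv> susp_space X \<tau>"
abbreviation "C \<equiv> susp_closed X \<tau>"
abbreviation "q \<equiv> susp_proj T \<tau>"
abbreviation "Top \<equiv> susp_top X T \<tau>"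
abbreviation "cont_real \<equiv> continuous_map Top euclideanreal"
abbreviation "flow \<equiv> susp_flow T \<tau>"
abbreviation "S \<equiv> roof_sum T \<tau>"

lemma T_in [simp]: "x \<in> X \<Longrightarrow> T x \<in> X" and g_in [simp]: "x \<in> X \<Longrightarrow> g x \<in> X"
  and gT [simp]: "x \<in> X \<Longrightarrow> g (T x) = x" and Tg [simp]: "x \<in> X \<Longrightarrow> T (g x) = x"
  and cont_T: "continuous_on X T" and cont_g: "continuous_on X g"
  using homeo by (auto simp: homeomorphism_def)

lemma funpow_in [simp]: "x \<in> X \<Longrightarrow> (T ^^ n) x \<in> X"
  by (induction n) auto

lemma continuous_on_funpow: "continuous_on X (T ^^ n)"
proof (induction n)
  case (Suc n)
  have "continuous_on X (T \<circ> (T ^^ n))"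
    by (intro continuous_on_compose Suc continuous_on_subset[OF cont_T]) auto
  then show ?case by simp
qed (simp add: continuous_on_id)

text \<open>The bounds are chosen rather than defined as extrema of the roof, so that they are
  positive for empty X as well.\<close>

definition roof_min :: real where "roof_min = (SOME m. 0 < m \<and> (\<forall>x\<in>X. m \<le> \<tau> x))"
definition roof_max :: real where "roof_max = (SOME m. 0 < m \<and> (\<forall>x\<in>X. \<tau> x \<le> m))"

lemma roof_min: "0 < roof_min" "x \<in> X \<Longrightarrow> roof_min \<le> \<tau> x"
proof -
  have "\<exists>m>0. \<forall>x\<in>X. m \<le> \<tau> x"
  proof (cases "X = {}")
    case False
    then obtain x where "x \<in> X" "\<forall>y\<in>X. \<tau> x \<le> \<tau> y"
      using continuous_attains_inf[OF compact _ cont_roof] by blast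
    then show ?thesis using roof_pos by blast
  qed (auto intro: exI[of _ 1])
  from someI_ex[OF this] show "0 < roof_min" "x \<in> X \<Longrightarrow> roof_min \<le> \<tau> x"
    by (auto simp: roof_min_def)
qed

lemma roof_max: "0 < roof_max" "x \<in> X \<Longrightarrow> \<tau> x \<le> roof_max"
proof -
  have "\<exists>m>0. \<forall>x\<in>X. \<tau> x \<le> m"
  proof (cases "X = {}")
    case False
    then obtain x where "x \<in> X" "\<forall>y\<in>X. \<tau> y \<le> \<tau> x"
      using continuous_attains_sup[OF compact _ cont_roof] by blast
    then show ?thesis using roof_pos by blast
  qed (auto intro: exI[of _ 1])
  from someI_ex[OF this] show "0 < roof_max" "x \<in> X \<Longrightarrow> \<tau> x \<le> roof_max"
    by (auto simp: roof_max_def)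
qed

section \<open>The suspension space as a quotient of the compact region under the roof\<close>

lemma C_iff: "(x, s) \<in> C \<longleftrightarrow> x \<in> X \<and> 0 \<le> s \<and> s \<le> \<tau> x"
  by (simp add: susp_closed_def)

lemma Y_iff: "(x, s) \<in> Y \<longleftrightarrow> x \<in> X \<and> 0 \<le> s \<and> s < \<tau> x"
  by (simp add: susp_space_def)

lemma q_in: "p \<in> C \<Longrightarrow> q p \<in> Y"
  using roof_pos by (cases p) (auto simp: C_iff Y_iff susp_proj_def)

lemma q_top: "q (x, \<tau> x) = (T x, 0)"
  by (simp add: susp_proj_def)

lemma q_id: "p \<in> Y \<Longrightarrow> q p = p"
  by (cases p) (auto simp: Y_iff susp_proj_def)

lemma Y_sub_C: "Y \<subseteq> C"
  by (auto simp: C_iff Y_iff)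

lemma openin_Top:
  "openin Top U \<longleftrightarrow> U \<subseteq> Y \<and> openin (top_of_set C) {p \<in> C. q p \<in> U}"
  unfolding susp_top_def by (subst topology_inverse'[OF istopology_susp_top]) rule

lemma topspace_Top [simp]: "topspace Top = Y"
proof
  show "topspace Top \<subseteq> Y" using openin_Top[of "topspace Top"] by auto
  have "{p \<in> C. q p \<in> Y} = C" using q_in by blast
  then have "openin Top Y" by (simp add: openin_Top)
  then show "Y \<subseteq> topspace Top" by (rule openin_subset)
qed

text \<open>Continuity of maps out of the suspension space can now be tested on C, which carries the
  product metric.\<close>

lemma quotient_q: "quotient_map (top_of_set C) Top q"
  unfolding quotient_map_def
proof (intro conjI allI impI)
  have "Y \<subseteq> q ` C" using q_id Y_sub_C by (metis image_eqI subsetD subsetI)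
  then show "q ` topspace (top_of_set C) = topspace Top" using q_in by auto
qed (auto simp: openin_Top)

text \<open>Rescaling heights by the roof makes C a continuous image of X \<times> [0, 1].\<close>

lemma compact_C: "compact C"
proof -
  have "C = (\<lambda>(x, r). (x, r * \<tau> x)) ` (X \<times> {0..1})"
  proof (intro set_eqI iffI)
    fix p assume p: "p \<in> C"
    obtain x s where xs: "p = (x, s)" by (cases p)
    then have "p = (\<lambda>(x, r). (x, r * \<tau> x)) (x, s / \<tau> x)" "(x, s / \<tau> x) \<in> X \<times> {0..1}"
      using p roof_pos[of x] by (auto simp: C_iff)
    then show "p \<in> (\<lambda>(x, r). (x, r * \<tau> x)) ` (X \<times> {0..1})" by blast
  next
    fix p assume "p \<in> (\<lambda>(x, r). (x, r * \<tau> x)) ` (X \<times> {0..1})"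
    then show "p \<in> C" using roof_pos by (auto simp: C_iff mult_left_le_one_le less_imp_le)
  qed
  moreover have "continuous_on (X \<times> {0..1::real}) (\<lambda>(x, r). (x, r * \<tau> x))"
    unfolding case_prod_beta
    by (intro continuous_intros continuous_on_compose2[OF cont_roof]) auto
  ultimately show ?thesis
    using compact_continuous_image compact_Times[OF compact compact_Icc] by metis
qed

lemma compact_Top: "compact_space Top"
proof -
  have "compactin Top (q ` C)"
    using compact_C quotient_imp_continuous_map[OF quotient_q]
    by (intro image_compactin[of "top_of_set C"]) (auto simp: compactin_subtopology)
  then show ?thesis
    using quotient_imp_surjective_map[OF quotient_q] by (simp add: compact_space_def)
qed

lemma cont_q: "cont_real f \<longleftrightarrow> continuous_on C (f \<circ> q)"
  using continuous_compose_quotient_map_eq[OF quotient_q, of euclideanreal f] by simp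

text \<open>Let K be the saturated complement of U in C and d the distance to K. The function d
  does not factor through q, since it may differ at (x, \<tau> x) and (T x, 0). Multiplying it by a
  factor that interpolates between the value of d at the partner of (x, 0) and that at the
  partner of (x, \<tau> x) repairs this without creating new zeros.\<close>
lemma open_cozero:
  assumes U: "openin Top U"
  shows "\<exists>h. cont_real h \<and> (\<forall>p\<in>Y. 0 \<le> h p) \<and> U = {p\<in>Y. 0 < h p}"
proof (cases "U = Y")
  case True
  then show ?thesis by (intro exI[of _ "\<lambda>_. 1"]) auto
next
  case False
  define K where "K = {p \<in> C. q p \<notin> U}"
  have UY: "U \<subseteq> Y" using U by (simp add: openin_Top)
  obtain p0 where "p0 \<in> Y" "p0 \<notin> U" using False UY by blast
  then have "p0 \<in> K" using q_id Y_sub_C by (auto simp: K_def)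
  then have Kne: "K \<noteq> {}" by blast
  have "K = C - {p \<in> C. q p \<in> U}" by (auto simp: K_def)
  then have "closedin (top_of_set C) K" using U by (simp add: openin_Top closedin_diff)
  then have clK: "closed K" using compact_C by (meson closedin_compact compact_imp_closed)
  define d where "d p = infdist p K" for p
  have d0: "d p = 0 \<longleftrightarrow> p \<in> K" for p
    unfolding d_def using in_closed_iff_infdist_zero[OF clK Kne] by blast
  have dn: "0 \<le> d p" for p by (simp add: d_def infdist_nonneg)
  have dp: "0 < d p \<longleftrightarrow> p \<notin> K" for p using d0[of p] dn[of p] by linarith
  define h where "h p = d p * ((1 - snd p / \<tau> (fst p)) * d (g (fst p), \<tau> (g (fst p)))
      + snd p / \<tau> (fst p) * d (T (fst p), 0) + snd p * (\<tau> (fst p) - snd p))" for p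
  have h_q: "h (q p) = h p" if p: "p \<in> C" for p
  proof (cases p)
    case (Pair x s)
    then have "x \<in> X" using p by (simp add: C_iff)
    then show ?thesis using Pair roof_pos[of x] roof_pos[of "T x"]
      by (auto simp: susp_proj_def h_def)
  qed
  have cd: "continuous_on A (\<lambda>x. d (F x))" if "continuous_on A F" for A and F :: "'a \<times> real \<Rightarrow> 'a \<times> real"
    unfolding d_def by (intro continuous_on_infdist that)
  have "continuous_on C h"
    unfolding h_def
    by (intro continuous_intros cd continuous_on_compose2[OF cont_roof]
        continuous_on_compose2[OF cont_T] continuous_on_compose2[OF cont_g])
      (auto simp: C_iff dest!: roof_pos)
  moreover have "continuous_on C (h \<circ> q) \<longleftrightarrow> continuous_on C h"
    using h_q by (intro continuous_on_cong) auto
  ultimately have "cont_real h" by (simp add: cont_q)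
  moreover have "0 \<le> h p \<and> (0 < h p \<longleftrightarrow> p \<in> U)" if p: "p \<in> Y" for p
  proof (cases p)
    case (Pair x s)
    then have x: "x \<in> X" "0 \<le> s" "s < \<tau> x" using p by (auto simp: Y_iff)
    have pU: "p \<in> U \<longleftrightarrow> 0 < d p" using p Y_sub_C q_id by (auto simp: dp K_def)
    show ?thesis
    proof (cases "s = 0")
      case True
      have "q (x, 0) = (x, 0)" "q (g x, \<tau> (g x)) = (x, 0)"
        using x True by (auto simp: susp_proj_def)
      then have "d (g x, \<tau> (g x)) = 0 \<longleftrightarrow> d (x, 0) = 0"
        using x roof_pos[of "g x"] by (auto simp: d0 K_def C_iff less_imp_le)
      moreover have "h p = d (x, 0) * d (g x, \<tau> (g x))" by (simp add: h_def Pair True)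
      ultimately show ?thesis using pU dn[of "(x, 0)"] dn[of "(g x, \<tau> (g x))"] Pair True
        by (auto simp: zero_less_mult_iff order_le_less)
    next
      case False
      have "0 < (1 - s / \<tau> x) * d (g x, \<tau> (g x)) + s / \<tau> x * d (T x, 0) + s * (\<tau> x - s)"
        using x False dn by (intro add_nonneg_pos add_nonneg_nonneg mult_nonneg_nonneg mult_pos_pos) auto
      then show ?thesis using pU dn[of p] by (simp add: h_def Pair zero_less_mult_iff)
    qed
  qed
  ultimately show ?thesis using UY by (intro exI[of _ h]) auto
qed

lemma bounded_cont:
  assumes "cont_real f" obtains B where "0 < B" "\<And>p. p \<in> Y \<Longrightarrow> \<bar>f p\<bar> \<le> B"
proof -
  have "compact (f ` Y)"
    using image_compactin[of Top Y euclideanreal f] compact_Top assms by (simp add: compact_space_def)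
  then show ?thesis
    using that bounded_pos by (metis compact_imp_bounded imageI real_norm_def)
qed

section \<open>Laps of an orbit, the semigroup law and continuity of the flow\<close>

lemma roof_sum_mono: "x \<in> X \<Longrightarrow> m \<le> n \<Longrightarrow> S m x \<le> S n x"
  by (rule lift_Suc_mono_le) (simp_all add: roof_sum_Suc less_imp_le roof_pos)

lemma roof_sum_ge: "x \<in> X \<Longrightarrow> roof_min * real n \<le> S n x"
proof (induction n)
  case (Suc n) then show ?case using roof_min(2)[of "(T ^^ n) x"] by (simp add: roof_sum_Suc algebra_simps)
qed simp

text \<open>Roof sums grow at least linearly, so some of them exceed u. The lap index is one less
  than the first such index, which is not 0 because u is nonnegative.\<close>

lemma lap_exists:
  assumes "x \<in> X" "0 \<le> u" shows "\<exists>n. S n x \<le> u \<and> u < S (Suc n) x"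
proof -
  obtain N where "u < real N * roof_min" using reals_Archimedean3[OF roof_min(1)] by blast
  then have N: "u < S N x" using roof_sum_ge[OF assms(1), of N] by (simp add: mult.commute)
  define k where "k = (LEAST n. u < S n x)"
  have k: "u < S k x" unfolding k_def using N by (rule LeastI)
  have "k \<noteq> 0" using k assms(2) by (metis not_less roof_sum_0)
  then obtain n where n: "k = Suc n" by (cases k) auto
  have "\<not> u < S n x" using not_less_Least[of n "\<lambda>n. u < S n x"] n by (auto simp: k_def)
  then show ?thesis using k n by (metis not_less)
qed

text \<open>The \<open>LEAST\<close> in the definition of the flow is replaced by the two
  inequalities that determine the lap; explicit computations of the flow go through this
  form.\<close>

lemma flow_eq:
  assumes "x \<in> X" "S n x \<le> s + t" "s + t < S (Suc n) x"
  shows "flow t (x, s) = ((T ^^ n) x, s + t - S n x)"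
proof -
  have "(LEAST n. s + t < S (Suc n) x) = n"
  proof (rule Least_equality)
    fix k assume "s + t < S (Suc k) x"
    then show "n \<le> k" using assms roof_sum_mono[of x "Suc k" n] by (auto simp: not_le[symmetric] Suc_le_eq)
  qed (rule assms)
  then show ?thesis by (simp add: susp_flow_def Let_def)
qed

lemma flow_in:
  assumes "p \<in> Y" "0 \<le> t" shows "flow t p \<in> Y"
proof (cases p)
  case (Pair x s)
  then have x: "x \<in> X" "0 \<le> s" using assms by (auto simp: Y_iff)
  then obtain n where n: "S n x \<le> s + t" "s + t < S (Suc n) x" using lap_exists[of x "s + t"] assms by auto
  then show ?thesis using x Pair by (simp add: flow_eq Y_iff roof_sum_Suc)
qed

lemma flow_add:
  assumes "p \<in> Y" "0 \<le> t" "0 \<le> u" shows "flow (t + u) p = flow u (flow t p)"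
proof (cases p)
  case (Pair x s)
  then have x: "x \<in> X" "0 \<le> s" using assms by (auto simp: Y_iff)
  obtain n where n: "S n x \<le> s + t" "s + t < S (Suc n) x" using lap_exists[of x "s + t"] assms x by auto
  define x' s' where "x' = (T ^^ n) x" and "s' = s + t - S n x"
  have x': "x' \<in> X" "0 \<le> s'" using n x by (auto simp: x'_def s'_def)
  obtain k where k: "S k x' \<le> s' + u" "s' + u < S (Suc k) x'"
    using lap_exists[of x' "s' + u"] assms x' by auto
  have "S (n + k) x \<le> s + (t + u)" "s + (t + u) < S (Suc (n + k)) x"
    using k unfolding add_Suc_right[symmetric] roof_sum_add by (auto simp: x'_def s'_def)
  then have "flow (t + u) p = ((T ^^ (n + k)) x, s + (t + u) - S (n + k) x)"
    using x Pair by (simp add: flow_eq)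
  also have "(T ^^ (n + k)) x = (T ^^ k) x'"
    by (simp add: x'_def add.commute[of n] funpow_add)
  also have "s + (t + u) - S (n + k) x = s' + u - S k x'"
    by (simp add: roof_sum_add x'_def s'_def)
  also have "((T ^^ k) x', s' + u - S k x') = flow u (flow t p)"
    using x n k x' Pair by (simp add: flow_eq x'_def s'_def)
  finally show ?thesis .
qed

lemma flow_0: "p \<in> Y \<Longrightarrow> flow 0 p = p"
  using flow_eq[of "fst p" 0 "snd p" 0] by (cases p) (auto simp: Y_iff roof_sum_Suc)

lemma flow_q_le:
  assumes "(x, s) \<in> C" "0 \<le> t" "s + t \<le> \<tau> x"
  shows "flow t (q (x, s)) = q (x, s + t)"
proof -
  have x: "x \<in> X" "0 \<le> s" using assms by (auto simp: C_iff)
  consider "s = \<tau> x" | "s < \<tau> x" "s + t = \<tau> x" | "s + t < \<tau> x" using assms by linarith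
  then show ?thesis
  proof cases
    case 1
    then show ?thesis using assms flow_0[of "(T x, 0)"] roof_pos[of "T x"] x by (auto simp: q_top Y_iff)
  next
    case 2
    then show ?thesis using flow_eq[of x 1 s t] x roof_pos[of "T x"]
      by (auto simp: susp_proj_def roof_sum_Suc)
  next
    case 3
    then show ?thesis using flow_eq[of x 0 s t] x assms by (auto simp: susp_proj_def roof_sum_Suc)
  qed
qed

text \<open>A time of at most \<open>roof_min\<close> leads past the roof only once: the new height
  is at most t, hence at most \<tau> (T x), so the image is again represented in the closed
  region.\<close>

lemma flow_q_ge:
  assumes "(x, s) \<in> C" "0 \<le> t" "t \<le> roof_min" "\<tau> x \<le> s + t"
  shows "(T x, s + t - \<tau> x) \<in> C" "flow t (q (x, s)) = q (T x, s + t - \<tau> x)"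
proof -
  have x: "x \<in> X" "0 \<le> s" "s \<le> \<tau> x" using assms by (auto simp: C_iff)
  have tx: "t \<le> \<tau> (T x)" using roof_min(2)[of "T x"] x assms by auto
  show "(T x, s + t - \<tau> x) \<in> C" using x tx assms by (auto simp: C_iff)
  show "flow t (q (x, s)) = q (T x, s + t - \<tau> x)"
  proof (cases "s = \<tau> x")
    case True
    have "flow t (q (T x, 0)) = q (T x, t)"
      using flow_q_le[of "T x" 0 t] x tx assms roof_pos[of "T x"] by (auto simp: C_iff)
    moreover have "q (T x, 0) = (T x, 0)" using roof_pos[of "T x"] x by (simp add: susp_proj_def)
    ultimately show ?thesis using True by (simp add: q_top)
  next
    case False
    then show ?thesis using flow_eq[of x 1 s t] x tx assms
      by (auto simp: susp_proj_def roof_sum_Suc)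
  qed
qed

text \<open>On each of two closed pieces of C, according to whether the roof is reached by time t,
  the flow is q after an explicit continuous map. Where the pieces meet, both formulas name the same
  point of the quotient, so they can be pasted.\<close>

lemma continuous_flow_small:
  assumes t: "0 \<le> t" "t \<le> roof_min" shows "continuous_map Top Top (flow t)"
proof (rule continuous_compose_quotient_map[OF quotient_q])
  define D where "D b = (if b then {p\<in>C. snd p + t \<le> \<tau> (fst p)} else {p\<in>C. \<tau> (fst p) \<le> snd p + t})" for b
  define F where "F b = (if b then (\<lambda>p. (fst p, snd p + t)) else (\<lambda>p. (T (fst p), snd p + t - \<tau> (fst p))))" for b
  have c\<tau>: "continuous_on C (\<lambda>p. \<tau> (fst p))"
    by (intro continuous_on_compose2[OF cont_roof] continuous_intros) (auto simp: C_iff)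
  have DC: "D b \<subseteq> C" for b by (auto simp: D_def)
  have qc: "continuous_map (top_of_set C) Top q" by (rule quotient_imp_continuous_map[OF quotient_q])
  show "continuous_map (top_of_set C) Top (flow t \<circ> q)"
  proof (rule pasting_lemma_closed[where I = UNIV and T = D and f = "\<lambda>b. q \<circ> F b"])
    fix b :: bool
    have "closedin (top_of_set C) (C \<inter> (\<lambda>p. \<tau> (fst p) - (snd p + t)) -` (if b then {0..} else {..0}))"
      by (intro continuous_closedin_preimage continuous_intros c\<tau>) auto
    also have "C \<inter> (\<lambda>p. \<tau> (fst p) - (snd p + t)) -` (if b then {0..} else {..0}) = D b"
      by (auto simp: D_def)
    finally show "closedin (top_of_set C) (D b)" .
    have "continuous_on (D b) (F b)"
    proof -
      have *: "continuous_on (D b) (\<lambda>p. \<tau> (fst p))" "continuous_on (D b) (\<lambda>p. T (fst p))"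
        using DC[of b]
        by (auto intro!: continuous_on_compose2[OF cont_T] continuous_intros
            intro: continuous_on_subset[OF c\<tau>] simp: C_iff subset_iff)
      then show ?thesis by (auto simp: F_def intro!: continuous_intros)
    qed
    moreover have "F b \<in> D b \<rightarrow> C"
      using t flow_q_ge(1)[OF _ t] by (auto simp: F_def D_def C_iff split: if_splits)
    ultimately have inner: "continuous_map (top_of_set (D b)) (top_of_set C) (F b)"
      by (simp add: continuous_map_in_subtopology image_subset_iff_funcset)
    show "continuous_map (subtopology (top_of_set C) (D b)) Top (q \<circ> F b)"
      unfolding subtopology_subtopology Int_absorb1[OF DC] by (rule continuous_map_compose[OF inner qc])
  next
    have eq: "(flow t \<circ> q) p = (q \<circ> F b) p" if "p \<in> D b" for b p
      using that flow_q_le[of "fst p" "snd p" t] flow_q_ge[of "fst p" "snd p" t] t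
      by (auto simp: D_def F_def split: if_splits)
    show "(q \<circ> F i) x = (q \<circ> F j) x" if "x \<in> topspace (top_of_set C) \<inter> D i \<inter> D j" for i j x
      using that eq by (metis IntD1 IntD2)
    show "\<exists>j. j \<in> UNIV \<and> x \<in> D j \<and> (flow t \<circ> q) x = (q \<circ> F j) x" if "x \<in> topspace (top_of_set C)" for x
    proof -
      have "x \<in> D True \<or> x \<in> D False" using that by (auto simp: D_def)
      then show ?thesis using eq by blast
    qed
  qed auto
qed

text \<open>The semigroup law splits t into steps of length at most \<open>roof_min\<close>.\<close>

lemma continuous_flow:
  assumes t: "0 \<le> t" shows "continuous_map Top Top (flow t)"
proof -
  have "continuous_map Top Top (flow t)" if "0 \<le> t" "t \<le> real n * roof_min" for n t
    using that
  proof (induction n arbitrary: t)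
    case 0 then show ?case using continuous_flow_small roof_min(1) by simp
  next
    case (Suc n)
    define u where "u = min t roof_min"
    have u: "0 \<le> u" "u \<le> roof_min" "0 \<le> t - u" "t - u \<le> real n * roof_min"
      using Suc.prems roof_min(1) by (auto simp: u_def min_def algebra_simps)
    have "continuous_map Top Top (flow (t - u) \<circ> flow u)"
      by (intro continuous_map_compose[OF continuous_flow_small Suc.IH] u)
    then show ?case
      by (rule continuous_map_eq) (use u flow_add[of _ u "t - u"] in auto)
  qed
  moreover obtain n where "t < real n * roof_min" using reals_Archimedean3[OF roof_min(1)] by blast
  ultimately show ?thesis using t by (meson less_imp_le)
qed

text \<open>Uniformity in p comes from uniform continuity of f \<circ> q on C. A short orbit piece
  may pass from (x, \<tau> x) to (T x, 0), where f \<circ> q has the same value; the parts before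
  and after cost e / 2 each.\<close>

lemma equicontinuous_flow:
  assumes f: "cont_real f" and e: "0 < e"
  obtains \<delta> where "0 < \<delta>" "\<And>p u. p \<in> Y \<Longrightarrow> 0 \<le> u \<Longrightarrow> u \<le> \<delta> \<Longrightarrow> \<bar>f (flow u p) - f p\<bar> < e"
proof -
  have "uniformly_continuous_on C (f \<circ> q)"
    using f compact_C by (simp add: cont_q compact_uniformly_continuous)
  then obtain d where d: "0 < d"
    "\<And>p p'. p \<in> C \<Longrightarrow> p' \<in> C \<Longrightarrow> dist p' p < d \<Longrightarrow> \<bar>f (q p') - f (q p)\<bar> < e / 2"
    unfolding uniformly_continuous_on_def using e by (metis comp_apply dist_real_def half_gt_zero)
  \<comment> \<open>\<open>roof_min\<close> limits the piece to one crossing, and d / 2 keeps each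
    vertical displacement strictly below d.\<close>
  show ?thesis
  proof (rule that[of "min roof_min (d / 2)"])
    show "0 < min roof_min (d / 2)" using d roof_min by simp
    fix p u assume p: "p \<in> Y" and u: "0 \<le> u" "u \<le> min roof_min (d / 2)"
    obtain x s where xs: "p = (x, s)" by (cases p)
    have x: "(x, s) \<in> C" "s < \<tau> x" "x \<in> X" "0 \<le> s" using p xs by (auto simp: Y_iff C_iff)
    have qp: "q (x, s) = p" using p xs q_id by simp
    show "\<bar>f (flow u p) - f p\<bar> < e"
    proof (cases "s + u \<le> \<tau> x")
      case True
      then have "\<bar>f (q (x, s + u)) - f (q (x, s))\<bar> < e / 2"
        using x u d(1) by (intro d(2)) (auto simp: C_iff dist_Pair_Pair dist_real_def)
      then show ?thesis using flow_q_le[of x s u] True x u e by (simp add: qp)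
    next
      case False
      have 1: "\<bar>f (q (x, \<tau> x)) - f (q (x, s))\<bar> < e / 2"
        using x u d(1) False by (intro d(2)) (auto simp: C_iff dist_Pair_Pair dist_real_def)
      have C': "(T x, s + u - \<tau> x) \<in> C" and fl: "flow u (q (x, s)) = q (T x, s + u - \<tau> x)"
        using flow_q_ge[of x s u] x u False by auto
      have 2: "\<bar>f (q (T x, s + u - \<tau> x)) - f (q (T x, 0))\<bar> < e / 2"
        using x u d(1) False C' by (intro d(2)) (auto simp: C_iff dist_Pair_Pair dist_real_def)
      have "q (T x, 0) = q (x, \<tau> x)" using roof_pos[of "T x"] x by (simp add: susp_proj_def)
      then have "f (q (T x, 0)) = f (q (x, \<tau> x))" by simp
      then show ?thesis using 1 2 unfolding qp[symmetric] fl by linarith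
    qed
  qed
qed

lemma continuous_on_flow:
  assumes f: "cont_real f" and p: "p \<in> Y" shows "continuous_on {0..} (\<lambda>u. f (flow u p))"
  unfolding continuous_on_iff
proof (intro ballI allI impI)
  fix u e :: real assume u: "u \<in> {0..}" and e: "0 < e"
  obtain d where d: "0 < d" "\<And>p u. p \<in> Y \<Longrightarrow> 0 \<le> u \<Longrightarrow> u \<le> d \<Longrightarrow> \<bar>f (flow u p) - f p\<bar> < e"
    using equicontinuous_flow[OF f e] by blast
  have *: "\<bar>f (flow b p) - f (flow a p)\<bar> < e" if "0 \<le> a" "a \<le> b" "b - a < d" for a b
    using d(2)[OF flow_in[OF p that(1)], of "b - a"] flow_add[OF p that(1), of "b - a"] that by simp
  show "\<exists>d>0. \<forall>x'\<in>{0..}. dist x' u < d \<longrightarrow> dist (f (flow x' p)) (f (flow u p)) < e"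
    using d(1)
  proof (intro exI[of _ d] conjI ballI impI)
    fix v assume v: "v \<in> {0..}" "dist v u < d"
    then show "dist (f (flow v p)) (f (flow u p)) < e"
      using *[of u v] *[of v u] u by (cases "u \<le> v") (auto simp: dist_real_def abs_minus_commute)
  qed
qed

lemma integrable_flow:
  assumes "cont_real f" "p \<in> Y" "0 \<le> a" shows "(\<lambda>u. f (flow u p)) integrable_on {a..b}"
  using assms by (intro integrable_continuous_real continuous_on_subset[OF continuous_on_flow]) auto

section \<open>Limit measures of orbits\<close>

abbreviation "avg \<equiv> susp_avg T \<tau>"

lemma integral_flow_bound:
  assumes "cont_real f" "p \<in> Y" "\<And>p. p \<in> Y \<Longrightarrow> \<bar>f p\<bar> \<le> B" "0 \<le> a" "a \<le> b"
  shows "\<bar>integral {a..b} (\<lambda>u. f (flow u p))\<bar> \<le> B * (b - a)"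
proof -
  have "continuous_on {a..b} (\<lambda>u. f (flow u p))"
    using assms by (intro continuous_on_subset[OF continuous_on_flow]) auto
  moreover have "\<bar>f (flow u p)\<bar> \<le> B" if "u \<in> {a..b}" for u
    using that assms by (intro assms(3) flow_in) auto
  ultimately show ?thesis using integral_bound[of a b "\<lambda>u. f (flow u p)" B] assms(5) by simp
qed

lemma avg_bound:
  assumes "cont_real f" "p \<in> Y" "\<And>p. p \<in> Y \<Longrightarrow> \<bar>f p\<bar> \<le> B" "0 < t"
  shows "\<bar>avg f p t\<bar> \<le> B"
  using integral_flow_bound[OF assms(1-3), of 0 t] assms(4)
  by (simp add: susp_avg_def abs_mult divide_simps mult.commute)

lemma avg_add: "cont_real f \<Longrightarrow> cont_real h \<Longrightarrow> p \<in> Y \<Longrightarrow> avg (\<lambda>y. f y + h y) p t = avg f p t + avg h p t"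
  by (simp add: susp_avg_def integral_add integrable_flow distrib_left add_divide_distrib)

lemma avg_scale: "avg (\<lambda>y. c * f y) p t = c * avg f p t"
  by (simp add: susp_avg_def)

lemma avg_nonneg:
  assumes "cont_real f" "\<And>p. p \<in> Y \<Longrightarrow> 0 \<le> f p" "p \<in> Y" "0 < t"
  shows "0 \<le> avg f p t"
proof -
  have "0 \<le> f (flow u p)" if "u \<in> {0..t}" for u
    using that assms by (intro assms(2) flow_in) auto
  then have "0 \<le> integral {0..t} (\<lambda>u. f (flow u p))"
    using assms by (intro integral_nonneg integrable_flow) auto
  then show ?thesis using assms(4) by (simp add: susp_avg_def)
qed

lemma avg_1: "0 < t \<Longrightarrow> avg (\<lambda>_. 1) p t = 1"
  by (simp add: susp_avg_def)

text \<open>Moving the time window [0, t] by s exchanges two end pieces of length s, each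
  contributing at most B s to the integral.\<close>

lemma avg_flow:
  assumes f: "cont_real f" and p: "p \<in> Y" and B: "\<And>p. p \<in> Y \<Longrightarrow> \<bar>f p\<bar> \<le> B" and s: "0 \<le> s" and t: "0 < t"
  shows "\<bar>avg (f \<circ> flow s) p t - avg f p t\<bar> \<le> 2 * B * s / t"
proof -
  let ?F = "\<lambda>u. f (flow u p)"
  have "integral {0..t} (\<lambda>u. f (flow s (flow u p))) = integral {0..t} (?F \<circ> (+) s)"
    using flow_add[OF p _ s] by (intro integral_cong) (simp add: add.commute)
  also have "\<dots> = integral {s..t+s} ?F" by (simp add: integral_shift_Icc_real)
  also have "\<dots> = integral {0..t} ?F + integral {t..t+s} ?F - integral {0..s} ?F"
    using Henstock_Kurzweil_Integration.integral_combine[of 0 t "t + s" ?F] Henstock_Kurzweil_Integration.integral_combine[of 0 s "t + s" ?F]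
      integrable_flow[OF f p] s t by simp
  finally have "\<bar>integral {0..t} (\<lambda>u. f (flow s (flow u p))) - integral {0..t} ?F\<bar> \<le> 2 * B * s"
    using integral_flow_bound[OF f p B, of t "t + s"] integral_flow_bound[OF f p B, of 0 s] s t
    by simp
  then show ?thesis
    using t by (simp add: susp_avg_def divide_right_mono flip: diff_divide_distrib)
qed

section \<open>Borel probability measures on the suspension space\<close>

lemma prob_measuresD:
  assumes "\<nu> \<in> susp_prob_measures X T \<tau>"
  shows "prob_space \<nu>" "space \<nu> = Y" "sets \<nu> = sigma_sets Y {U. openin Top U}"
proof -
  have *: "{U. openin Top U} \<subseteq> Pow Y" by (auto simp: openin_Top)
  show "prob_space \<nu>" using assms by (simp add: susp_prob_measures_def)
  have s: "sets \<nu> = sets (susp_borel X T \<tau>)" using assms by (simp add: susp_prob_measures_def)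
  then show "sets \<nu> = sigma_sets Y {U. openin Top U}" using * by (simp add: susp_borel_def)
  show "space \<nu> = Y" using sets_eq_imp_space_eq[OF s] * by (simp add: susp_borel_def space_measure_of_conv)
qed

lemma open_sets: "\<nu> \<in> susp_prob_measures X T \<tau> \<Longrightarrow> openin Top U \<Longrightarrow> U \<in> sets \<nu>"
  by (auto simp: prob_measuresD)

lemma cont_measurable:
  assumes \<nu>: "\<nu> \<in> susp_prob_measures X T \<tau>" and f: "cont_real f"
  shows "f \<in> borel_measurable \<nu>"
proof (rule borel_measurableI)
  fix A :: "real set" assume "open A"
  then have "openin Top {y\<in>Y. f y \<in> A}" using openin_continuous_map_preimage[OF f] by simp
  moreover have "f -` A \<inter> space \<nu> = {y\<in>Y. f y \<in> A}" by (auto simp: prob_measuresD[OF \<nu>])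
  ultimately show "f -` A \<inter> space \<nu> \<in> sets \<nu>" using open_sets[OF \<nu>] by simp
qed

lemma cont_integrable:
  assumes \<nu>: "\<nu> \<in> susp_prob_measures X T \<tau>" and f: "cont_real f"
  shows "integrable \<nu> f"
proof -
  interpret prob_space \<nu> using prob_measuresD[OF \<nu>] by simp
  obtain B where "\<And>p. p \<in> Y \<Longrightarrow> \<bar>f p\<bar> \<le> B" using bounded_cont[OF f] by blast
  then show ?thesis
    by (intro integrable_const_bound[of _ B] cont_measurable[OF \<nu> f] AE_I2) (auto simp: prob_measuresD[OF \<nu>])
qed

lemma flow_measurable:
  assumes \<nu>: "\<nu> \<in> susp_prob_measures X T \<tau>" and s: "0 \<le> s"
  shows "flow s \<in> measurable \<nu> \<nu>"
proof (rule measurable_sigma_sets[OF prob_measuresD(3)[OF \<nu>]])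
  show "flow s \<in> space \<nu> \<rightarrow> Y" using flow_in[OF _ s] by (auto simp: prob_measuresD[OF \<nu>])
  fix U assume "U \<in> {U. openin Top U}"
  then have "openin Top {y\<in>Y. flow s y \<in> U}"
    using openin_continuous_map_preimage[OF continuous_flow[OF s]] by simp
  moreover have "flow s -` U \<inter> space \<nu> = {y\<in>Y. flow s y \<in> U}" by (auto simp: prob_measuresD[OF \<nu>])
  ultimately show "flow s -` U \<inter> space \<nu> \<in> sets \<nu>" using open_sets[OF \<nu>] by simp
qed (auto simp: openin_Top)

lemma open_measure_lim:
  assumes \<nu>: "\<nu> \<in> susp_prob_measures X T \<tau>" and h: "cont_real h" "\<And>p. p \<in> Y \<Longrightarrow> 0 \<le> h p"
    and U: "U = {p\<in>Y. 0 < h p}"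
  shows "(\<lambda>n. integral\<^sup>L \<nu> (\<lambda>p. min 1 (real n * h p))) \<longlonglongrightarrow> measure \<nu> U"
proof -
  interpret prob_space \<nu> using prob_measuresD[OF \<nu>] by simp
  have "openin Top {p\<in>Y. h p \<in> {0<..}}" using openin_continuous_map_preimage[OF h(1), of "{0<..}"] by simp
  then have Us: "U \<in> sets \<nu>" using open_sets[OF \<nu>] by (simp add: U)
  have "(\<lambda>n. integral\<^sup>L \<nu> (\<lambda>p. min 1 (real n * h p))) \<longlonglongrightarrow> integral\<^sup>L \<nu> (indicator U)"
  proof (rule integral_dominated_convergence[where w = "\<lambda>_. 1"])
    have c: "cont_real (\<lambda>p. min 1 (real n * h p))" for n
      by (intro continuous_map_real_min continuous_map_real_mult_left h) auto
    show "(\<lambda>p. min 1 (real n * h p)) \<in> borel_measurable \<nu>" for n by (intro cont_measurable[OF \<nu>] c)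
    show "AE p in \<nu>. norm (min 1 (real n * h p)) \<le> 1" for n
      using h(2) by (intro AE_I2) (auto simp: prob_measuresD[OF \<nu>] abs_le_iff min_def)
    show "AE p in \<nu>. (\<lambda>n. min 1 (real n * h p)) \<longlonglongrightarrow> indicator U p"
    proof (rule AE_I2)
      fix p assume "p \<in> space \<nu>"
      then have p: "p \<in> Y" by (simp add: prob_measuresD[OF \<nu>])
      show "(\<lambda>n. min 1 (real n * h p)) \<longlonglongrightarrow> indicator U p"
      proof (cases "p \<in> U")
        case False
        then have "h p = 0" using h(2)[OF p] p by (simp add: U)
        then show ?thesis using False by simp
      next
        case True
        then have hp: "0 < h p" by (simp add: U)
        then obtain N where N: "1 < real N * h p" using reals_Archimedean3 by blast
        have "min 1 (real n * h p) = 1" if "N \<le> n" for n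
        proof -
          have "real N * h p \<le> real n * h p" using that hp by simp
          then show ?thesis using N by simp
        qed
        then have "eventually (\<lambda>n. min 1 (real n * h p) = indicator U p) sequentially"
          using True by (auto simp: eventually_sequentially)
        then show ?thesis by (rule tendsto_eventually)
      qed
    qed
  qed (use Us in auto)
  then show ?thesis using Us by simp
qed

text \<open>Open sets form a \<pi>-system, and each is a cozero set, whose measure is a limit of
  integrals of continuous functions by \<open>open_measure_lim\<close>.\<close>

lemma prob_measures_eqI:
  assumes \<mu>: "\<mu> \<in> susp_prob_measures X T \<tau>" and \<nu>: "\<nu> \<in> susp_prob_measures X T \<tau>"
    and eq: "\<And>f. cont_real f \<Longrightarrow> integral\<^sup>L \<mu> f = integral\<^sup>L \<nu> f"
  shows "\<mu> = \<nu>"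
proof (rule measure_eqI_generator_eq[where \<Omega> = Y and E = "{U. openin Top U}" and A = "\<lambda>_. Y"])
  interpret \<mu>: prob_space \<mu> using prob_measuresD[OF \<mu>] by simp
  interpret \<nu>: prob_space \<nu> using prob_measuresD[OF \<nu>] by simp
  show "Int_stable {U. openin Top U}" by (auto simp: Int_stable_def)
  show "emeasure \<mu> U = emeasure \<nu> U" if U: "U \<in> {U. openin Top U}" for U
  proof -
    obtain h where h: "cont_real h" "\<And>p. p \<in> Y \<Longrightarrow> 0 \<le> h p" "U = {p\<in>Y. 0 < h p}"
      using open_cozero[of U] U by auto
    have "cont_real (\<lambda>p. min 1 (real n * h p))" for n
      by (intro continuous_map_real_min continuous_map_real_mult_left h) auto
    then have "measure \<mu> U = measure \<nu> U"
      using LIMSEQ_unique[OF open_measure_lim[OF \<mu> h]] open_measure_lim[OF \<nu> h] by (simp add: eq)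
    then show ?thesis by (simp add: \<mu>.emeasure_eq_measure \<nu>.emeasure_eq_measure)
  qed
  show "emeasure \<mu> Y \<noteq> \<infinity>" by simp
  show "range (\<lambda>_. Y) \<subseteq> {U. openin Top U}" using openin_topspace[of Top] by simp
qed (auto simp: prob_measuresD[OF \<mu>] prob_measuresD[OF \<nu>] openin_Top)

text \<open>The averages of f and of f \<circ> flow s up to time t differ by a multiple of s / t, so
  a limit point gives both functions the same integral.\<close>

lemma V_invariant:
  assumes p: "p \<in> Y" and \<nu>: "\<nu> \<in> susp_V X T \<tau> p"
  shows "\<nu> \<in> susp_inv_measures X T \<tau>"
proof -
  have \<nu>P: "\<nu> \<in> susp_prob_measures X T \<tau>" using \<nu> by (simp add: susp_V_def)
  interpret prob_space \<nu> using prob_measuresD[OF \<nu>P] by simp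
  have eq: "integral\<^sup>L \<nu> (f \<circ> flow s) = integral\<^sup>L \<nu> f" if f: "cont_real f" and s: "0 \<le> s" for f s
  proof (rule ccontr)
    assume ne: "integral\<^sup>L \<nu> (f \<circ> flow s) \<noteq> integral\<^sup>L \<nu> f"
    \<comment> \<open>A third of the discrepancy: two approximation errors and the shift error, each
      at most e, will not add up to it.\<close>
    define e where "e = \<bar>integral\<^sup>L \<nu> (f \<circ> flow s) - integral\<^sup>L \<nu> f\<bar> / 3"
    have e: "0 < e" using ne by (simp add: e_def)
    obtain B where B: "0 < B" "\<And>p. p \<in> Y \<Longrightarrow> \<bar>f p\<bar> \<le> B" using bounded_cont[OF f] by blast
    have cf: "cont_real (f \<circ> flow s)" by (intro continuous_map_compose[OF continuous_flow] s f)
    \<comment> \<open>Both functions enter one finite family, so that a single time t approximates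
      both integrals.\<close>
    have "\<forall>\<epsilon>>0. \<forall>t0. \<exists>t\<ge>t0. \<forall>h\<in>{f, f \<circ> flow s}. \<bar>avg h p t - integral\<^sup>L \<nu> h\<bar> < \<epsilon>"
    proof -
      have "finite {f, f \<circ> flow s} \<and> (\<forall>h\<in>{f, f \<circ> flow s}. cont_real h)" using f cf by simp
      then show ?thesis using \<nu> unfolding susp_V_def mem_Collect_eq by metis
    qed
    then obtain t where t: "t \<ge> 1 + 2 * B * s / e"
      and tf: "\<bar>avg f p t - integral\<^sup>L \<nu> f\<bar> < e"
        "\<bar>avg (f \<circ> flow s) p t - integral\<^sup>L \<nu> (f \<circ> flow s)\<bar> < e"
      using e by (meson insertCI)
    have t0: "0 < t" using t e B s by (smt (verit) divide_nonneg_pos mult_nonneg_nonneg)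
    have "2 * B * s / e \<le> t" using t by simp
    then have "2 * B * s / t \<le> e" using e t0 by (simp add: field_simps)
    then have "\<bar>avg (f \<circ> flow s) p t - avg f p t\<bar> \<le> e"
      using avg_flow[OF f p B(2) s t0] by linarith
    then have "\<bar>integral\<^sup>L \<nu> (f \<circ> flow s) - integral\<^sup>L \<nu> f\<bar> < 3 * e" using tf by linarith
    then show False by (simp add: e_def)
  qed
  have "distr \<nu> \<nu> (flow s) = \<nu>" if s: "0 \<le> s" for s
  proof (rule prob_measures_eqI[OF _ \<nu>P])
    show "distr \<nu> \<nu> (flow s) \<in> susp_prob_measures X T \<tau>"
      using \<nu>P prob_space_distr[OF flow_measurable[OF \<nu>P s]] by (simp add: susp_prob_measures_def)
    show "integral\<^sup>L (distr \<nu> \<nu> (flow s)) f = integral\<^sup>L \<nu> f" if "cont_real f" for f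
      using eq[OF that s] by (simp add: integral_distr flow_measurable[OF \<nu>P s] cont_measurable[OF \<nu>P that] comp_def)
  qed
  then show ?thesis using \<nu>P flow_measurable[OF \<nu>P] by (simp add: susp_inv_measures_def)
qed

text \<open>The averages of all continuous functions form a point of a product of compact intervals
  and hence cluster. The predicate P restricts the times, so that a choice of times with large
  averages of one function carries over to the limit.\<close>

lemma cluster_functional:
  assumes p: "p \<in> Y" and fr: "frequently P at_top"
  obtains L where "\<And>F e t0. finite F \<Longrightarrow> (\<And>f. f \<in> F \<Longrightarrow> cont_real f) \<Longrightarrow> 0 < e \<Longrightarrow>
    \<exists>t\<ge>t0. P t \<and> 0 < t \<and> (\<forall>f\<in>F. \<bar>avg f p t - L f\<bar> < e)"
proof -
  define B where "B f = (SOME B. \<forall>p\<in>Y. \<bar>f p\<bar> \<le> B)" for f :: "'a \<times> real \<Rightarrow> real"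
  have B: "\<bar>f p\<bar> \<le> B f" if "cont_real f" "p \<in> Y" for f p
  proof -
    have "\<exists>B. \<forall>p\<in>Y. \<bar>f p\<bar> \<le> B" using bounded_cont[OF that(1)] by metis
    from someI_ex[OF this] show ?thesis using that(2) by (simp add: B_def)
  qed
  \<comment> \<open>Coordinates belonging to discontinuous functions are set to 0, which gives the
    box \<open>K\<close> a compact one-point factor there.\<close>
  define v where "v t f = (if cont_real f then avg f p t else 0)" for t f
  define K where "K = PiE UNIV (\<lambda>f. if cont_real f then {- B f..B f} else {0})"
  have "compactin (product_topology (\<lambda>_. euclideanreal) UNIV) K"
    unfolding K_def compactin_PiE by auto
  then have K: "compact K" by (simp add: euclidean_product_topology)
  \<comment> \<open>Times tending to infinity within P; the filter is proper because P holds at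
    arbitrarily large times.\<close>
  define \<F> where "\<F> = inf at_top (principal {t. P t \<and> 0 < t})"
  have ev0: "eventually (\<lambda>t. 0 < t) (at_top :: real filter)" by (rule eventually_gt_at_top)
  have ne: "\<F> \<noteq> bot"
  proof
    assume "\<F> = bot"
    then have "eventually (\<lambda>t. \<not> (P t \<and> 0 < t)) at_top"
      by (simp add: \<F>_def trivial_limit_def eventually_inf_principal)
    then have "eventually (\<lambda>t. \<not> P t) at_top" using ev0 by eventually_elim auto
    then show False using fr by (simp add: frequently_def)
  qed
  have "eventually (\<lambda>t. v t \<in> K) \<F>"
    unfolding \<F>_def eventually_inf_principal
  proof (intro always_eventually allI impI)
    fix t assume "t \<in> {t. P t \<and> 0 < t}"
    then have "\<bar>avg f p t\<bar> \<le> B f" if "cont_real f" for f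
      using avg_bound[OF that p B[OF that]] by simp
    then show "v t \<in> K" by (auto simp: K_def v_def abs_le_iff minus_le_iff)
  qed
  then have "eventually (\<lambda>w. w \<in> K) (filtermap v \<F>)" by (simp add: eventually_filtermap)
  moreover have "filtermap v \<F> \<noteq> bot" using ne by (simp add: filtermap_bot_iff)
  ultimately obtain L where L: "inf (nhds L) (filtermap v \<F>) \<noteq> bot"
    using K[unfolded compact_filter, rule_format, of "filtermap v \<F>"] by auto
  show ?thesis
  proof (rule that[of L])
    fix F :: "('a \<times> real \<Rightarrow> real) set" and e t0 :: real
    assume F: "finite F" "\<And>f. f \<in> F \<Longrightarrow> cont_real f" and e: "0 < e"
    define W where "W = (\<Inter>f\<in>F. {w::('a \<times> real \<Rightarrow> real) \<Rightarrow> real. \<bar>w f - L f\<bar> < e})"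
    have "open W"
      unfolding W_def using F(1)
      by (intro open_INT ballI open_Collect_less continuous_intros continuous_on_product_coordinates) auto
    moreover have "L \<in> W" using e by (simp add: W_def)
    ultimately have W: "eventually (\<lambda>w. w \<in> W) (nhds L)" by (simp add: eventually_nhds) blast
    have "\<exists>t\<ge>t0. P t \<and> 0 < t \<and> v t \<in> W"
    proof (rule ccontr)
      assume "\<not> ?thesis"
      then have "eventually (\<lambda>t. v t \<notin> W) \<F>"
        unfolding \<F>_def eventually_inf_principal
        by (intro eventually_mono[OF eventually_ge_at_top[of t0]]) auto
      then have "eventually (\<lambda>w. w \<notin> W) (filtermap v \<F>)" by (simp add: eventually_filtermap)
      with W have "eventually (\<lambda>w. False) (inf (nhds L) (filtermap v \<F>))"
        unfolding eventually_inf by blast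
      then show False using L by (simp add: trivial_limit_def)
    qed
    then show "\<exists>t\<ge>t0. P t \<and> 0 < t \<and> (\<forall>f\<in>F. \<bar>avg f p t - L f\<bar> < e)"
      using F(2) by (auto simp: W_def v_def)
  qed
qed

text \<open>Averages over one orbit up to one time are linear, positive and normalised. Each such
  relation involves finitely many functions, which are approximated at a common time, so
  \<open>L\<close> inherits it and the representation theorem applies.\<close>

lemma V_exists:
  assumes p: "p \<in> Y" and H: "cont_real H" and fr: "frequently (\<lambda>t. r < avg H p t) at_top"
  obtains \<nu> where "\<nu> \<in> susp_V X T \<tau> p" "r \<le> integral\<^sup>L \<nu> H"
proof -
  obtain L where L: "\<And>F e t0. finite F \<Longrightarrow> (\<And>f. f \<in> F \<Longrightarrow> cont_real f) \<Longrightarrow> 0 < e \<Longrightarrow>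
    \<exists>t\<ge>t0. r < avg H p t \<and> 0 < t \<and> (\<forall>f\<in>F. \<bar>avg f p t - L f\<bar> < e)"
    using cluster_functional[OF p fr] by blast
  \<comment> \<open>Identities for \<open>L\<close> are reached up to a fixed multiple of an
    arbitrary e: 3 e for sums, (1 + |c|) e for multiples.\<close>
  have *: "x = 0" if "\<And>e. 0 < e \<Longrightarrow> \<bar>x\<bar> \<le> (K::real) * e" "0 < K" for x K
  proof (rule ccontr)
    assume "x \<noteq> 0"
    then have "\<bar>x\<bar> \<le> K * (\<bar>x\<bar> / (2 * K))" using that by (intro that(1)) auto
    then show False using \<open>x \<noteq> 0\<close> that(2) by simp
  qed
  interpret positive_functional Top L
  proof
    fix f h :: "'a \<times> real \<Rightarrow> real" and c :: real
    assume f: "cont_real f"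
    show "L (\<lambda>y. f y + h y) = L f + L h" if h: "cont_real h"
    proof -
      have "L (\<lambda>y. f y + h y) - (L f + L h) = 0"
      proof (rule *[of _ 3])
        fix e :: real assume "0 < e"
        then have "\<exists>t\<ge>0. r < avg H p t \<and> 0 < t \<and>
          (\<forall>g\<in>{f, h, \<lambda>y. f y + h y}. \<bar>avg g p t - L g\<bar> < e)"
          using f h by (intro L) (auto intro: continuous_map_add)
        then show "\<bar>L (\<lambda>y. f y + h y) - (L f + L h)\<bar> \<le> 3 * e"
          using avg_add[OF f h p] by auto
      qed simp
      then show ?thesis by simp
    qed
    show "L (\<lambda>y. c * f y) = c * L f"
    proof -
      have "L (\<lambda>y. c * f y) - c * L f = 0"
      proof (rule *[of _ "1 + \<bar>c\<bar>"])
        fix e :: real assume "0 < e"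
        then have "\<exists>t\<ge>0. r < avg H p t \<and> 0 < t \<and>
          (\<forall>g\<in>{f, \<lambda>y. c * f y}. \<bar>avg g p t - L g\<bar> < e)"
          using f by (intro L) (auto intro: continuous_map_real_mult_left)
        then obtain t where t: "\<bar>avg f p t - L f\<bar> < e" "\<bar>c * avg f p t - L (\<lambda>y. c * f y)\<bar> < e"
          by (auto simp: avg_scale)
        have "\<bar>c * avg f p t - c * L f\<bar> \<le> \<bar>c\<bar> * e"
          using t(1) by (simp add: abs_mult mult_left_mono flip: right_diff_distrib)
        then show "\<bar>L (\<lambda>y. c * f y) - c * L f\<bar> \<le> (1 + \<bar>c\<bar>) * e"
          using t(2) by (simp add: distrib_right)
      qed simp
      then show ?thesis by simp
    qed
    show "0 \<le> L f" if "\<And>y. y \<in> topspace Top \<Longrightarrow> 0 \<le> f y"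
    proof (rule field_le_epsilon)
      fix e :: real assume "0 < e"
      then have "\<exists>t\<ge>0. r < avg H p t \<and> 0 < t \<and> (\<forall>g\<in>{f}. \<bar>avg g p t - L g\<bar> < e)"
        using f by (intro L) auto
      then obtain t where "0 < t" "\<bar>avg f p t - L f\<bar> < e" by auto
      then show "0 \<le> L f + e" using avg_nonneg[OF f _ p] that by fastforce
    qed
  next
    show "L (\<lambda>y. 1) = 1"
    proof -
      have "L (\<lambda>y. 1) - 1 = 0"
      proof (rule *[of _ 1])
        fix e :: real assume "0 < e"
        then have "\<exists>t\<ge>0. r < avg H p t \<and> 0 < t \<and> (\<forall>g\<in>{\<lambda>_. 1}. \<bar>avg g p t - L g\<bar> < e)"
          by (intro L) auto
        then show "\<bar>L (\<lambda>y. 1) - 1\<bar> \<le> 1 * e" by (auto simp: avg_1)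
      qed simp
      then show ?thesis by simp
    qed
  qed (rule compact_Top)
  obtain \<nu> where \<nu>: "prob_space \<nu>" "sets \<nu> = sets (sigma (topspace Top) {U. openin Top U})"
    "\<And>f. cont_real f \<Longrightarrow> integral\<^sup>L \<nu> f = L f"
  proof -
    have "\<exists>h. cont_nonneg h \<and> U = {y \<in> topspace Top. 0 < h y}" if "openin Top U" for U
      using open_cozero[OF that] by (simp add: cont_nonneg_def conj_assoc)
    then show ?thesis using exists_measure that by blast
  qed
  show ?thesis
  proof (rule that[of \<nu>])
    have "\<exists>t\<ge>t0. \<forall>f\<in>F. \<bar>avg f p t - integral\<^sup>L \<nu> f\<bar> < \<epsilon>"
      if "finite F" "\<forall>f\<in>F. cont_real f" "0 < \<epsilon>" for F and \<epsilon> t0 :: real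
      using L[of F \<epsilon> t0] that \<nu>(3) by metis
    then show "\<nu> \<in> susp_V X T \<tau> p"
      using \<nu> by (auto simp: susp_V_def susp_prob_measures_def susp_borel_def)
    show "r \<le> integral\<^sup>L \<nu> H"
    proof (rule field_le_epsilon)
      fix e :: real assume "0 < e"
      then have "\<exists>t\<ge>0. r < avg H p t \<and> 0 < t \<and> (\<forall>g\<in>{H}. \<bar>avg g p t - L g\<bar> < e)"
        using H by (intro L) auto
      then show "r \<le> integral\<^sup>L \<nu> H + e" using \<nu>(3)[OF H] by auto
    qed
  qed
qed

section \<open>Gluing orbit segments\<close>

text \<open>The integral of f over one lap from (x, 0), substituted to the fixed interval [0, 1] so
  that continuity in x is that of a parameter integral; \<open>hat_eq\<close> undoes the
  substitution.\<close>

definition hat :: "('a \<times> real \<Rightarrow> real) \<Rightarrow> 'a \<Rightarrow> real" where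
  "hat f x = \<tau> x * integral {0..1} (\<lambda>r. f (q (x, r * \<tau> x)))"

lemma continuous_on_hat:
  assumes f: "cont_real f" shows "continuous_on X (hat f)"
proof -
  have "continuous_on (X \<times> cbox 0 1) ((f \<circ> q) \<circ> (\<lambda>(x, r). (x, r * \<tau> x)))"
    unfolding case_prod_beta
  proof (rule continuous_on_compose)
    show "continuous_on (X \<times> cbox 0 1) (\<lambda>p. (fst p, snd p * \<tau> (fst p)))"
      by (intro continuous_intros continuous_on_compose2[OF cont_roof]) auto
    have "(\<lambda>p. (fst p, snd p * \<tau> (fst p))) ` (X \<times> cbox 0 1) \<subseteq> C"
      using roof_pos by (auto simp: C_iff mult_left_le_one_le less_imp_le)
    then show "continuous_on ((\<lambda>p. (fst p, snd p * \<tau> (fst p))) ` (X \<times> cbox 0 1)) (f \<circ> q)"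
      by (rule continuous_on_subset[OF f[unfolded cont_q]])
  qed
  then have "continuous_on X (\<lambda>x. integral (cbox 0 1) (\<lambda>r. f (q (x, r * \<tau> x))))"
    by (intro integral_continuous_on_param) (simp add: comp_def case_prod_beta)
  then show ?thesis unfolding hat_def by (intro continuous_intros cont_roof) simp
qed

lemma base_in: "x \<in> X \<Longrightarrow> (x, 0) \<in> Y"
  by (simp add: Y_iff roof_pos)

lemma hat_eq:
  assumes f: "cont_real f" and x: "x \<in> X"
  shows "hat f x = integral {0..\<tau> x} (\<lambda>u. f (flow u (x, 0)))"
proof -
  have fl: "flow u (x, 0) = q (x, u)" if "u \<in> {0..\<tau> x}" for u
    using flow_q_le[of x 0 u] q_id[OF base_in[OF x]] x that roof_pos[OF x] by (simp add: C_iff)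
  have eq: "integral {0..\<tau> x} (\<lambda>u. f (flow u (x, 0))) = integral {0..\<tau> x} (\<lambda>u. f (q (x, u)))"
    by (intro integral_cong) (simp add: fl)
  have "(\<lambda>u. f (q (x, u))) integrable_on {0..\<tau> x}"
    by (rule integrable_eq[OF integrable_flow[OF f base_in[OF x] order_refl]]) (simp add: fl)
  then have "((\<lambda>u. f (q (x, u))) has_integral integral {0..\<tau> x} (\<lambda>u. f (q (x, u)))) (cbox 0 (\<tau> x))"
    by (simp add: integrable_integral)
  from has_integral_affinity'[OF this roof_pos[OF x], of 0]
  have "((\<lambda>r. f (q (x, r * \<tau> x))) has_integral integral {0..\<tau> x} (\<lambda>u. f (q (x, u))) / \<tau> x) {0..1}"
    using roof_pos[OF x] by (simp add: divide_inverse mult.commute)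
  then have "integral {0..1} (\<lambda>r. f (q (x, r * \<tau> x))) = integral {0..\<tau> x} (\<lambda>u. f (q (x, u))) / \<tau> x"
    by (rule integral_unique)
  then show ?thesis using roof_pos[OF x] by (simp add: hat_def eq)
qed

text \<open>The lap after n returns starts at ((T ^^ n) x, 0) and contributes \<open>hat f\<close>
  at that base point. Despite its name, \<open>roof_sum\<close> serves here as the Birkhoff sum of
  \<open>hat f\<close>.\<close>

lemma integral_laps:
  assumes f: "cont_real f" and x: "x \<in> X"
  shows "integral {0..S n x} (\<lambda>u. f (flow u (x, 0))) = roof_sum T (hat f) n x"
proof (induction n)
  case (Suc n)
  let ?G = "\<lambda>u. f (flow u (x, 0))"
  have S0: "0 \<le> S n x" using roof_sum_mono[OF x, of 0 n] by simp
  have \<tau>: "0 < \<tau> ((T ^^ n) x)" using x by (simp add: roof_pos)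
  have fl: "flow (S n x) (x, 0) = ((T ^^ n) x, 0)"
    using flow_eq[OF x, of n 0 "S n x"] \<tau> by (simp add: roof_sum_Suc)
  have "integral {S n x..S (Suc n) x} ?G = integral {0..\<tau> ((T ^^ n) x)} (?G \<circ> (+) (S n x))"
    by (simp add: integral_shift_Icc_real roof_sum_Suc add.commute)
  also have "\<dots> = integral {0..\<tau> ((T ^^ n) x)} (\<lambda>u. f (flow u ((T ^^ n) x, 0)))"
    using flow_add[OF base_in[OF x] S0] by (intro integral_cong) (simp add: fl)
  also have "\<dots> = hat f ((T ^^ n) x)" using x f by (simp add: hat_eq)
  finally show ?case
    using Henstock_Kurzweil_Integration.integral_combine[of 0 "S n x" "S (Suc n) x" ?G]
      integrable_flow[OF f base_in[OF x], of 0] S0 \<tau> Suc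
    by (simp add: roof_sum_Suc)
qed simp

lemma avg_laps:
  "cont_real f \<Longrightarrow> x \<in> X \<Longrightarrow> avg f (x, 0) (S n x) = roof_sum T (hat f) n x / S n x"
  by (simp add: susp_avg_def integral_laps)

text \<open>The average of f over the times 0, \<delta>, ..., (K - 1) \<delta> has \<nu>-mean equal to that
  of f, so it is almost as large at some point; no ergodic theorem is needed.\<close>
lemma orbit_segment:
  assumes \<nu>: "\<nu> \<in> susp_inv_measures X T \<tau>" and f: "cont_real f" and e: "0 < e"
  shows "\<exists>n\<ge>N. \<exists>x\<in>X. (integral\<^sup>L \<nu> f - e) * S n x \<le> roof_sum T (hat f) n x"
proof -
  define c where "c = integral\<^sup>L \<nu> f"
  have \<nu>P: "\<nu> \<in> susp_prob_measures X T \<tau>" using \<nu> by (simp add: susp_inv_measures_def)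
  interpret prob_space \<nu> using prob_measuresD[OF \<nu>P] by simp
  obtain B where B: "0 < B" "\<And>p. p \<in> Y \<Longrightarrow> \<bar>f p\<bar> \<le> B" using bounded_cont[OF f] by blast
  obtain \<delta> where \<delta>: "0 < \<delta>" "\<And>p u. p \<in> Y \<Longrightarrow> 0 \<le> u \<Longrightarrow> u \<le> \<delta> \<Longrightarrow> \<bar>f (flow u p) - f p\<bar> < e / 4"
    using equicontinuous_flow[OF f, of "e / 4"] e by auto
  define M where "M = roof_max"
  \<comment> \<open>The total error of passing from time t to whole laps: \<open>2 * B * M\<close>
    for the incomplete laps at both ends, the rest for replacing t by \<open>S n x\<close>, which
    differs from t by at most M.\<close>
  define D where "D = M * \<bar>c - e / 2\<bar> + 2 * B * M"
  have M: "0 < M" "\<And>x. x \<in> X \<Longrightarrow> \<tau> x \<le> M" using roof_max by (auto simp: M_def)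
  have D: "0 \<le> D" using M B by (simp add: D_def)
  \<comment> \<open>The time t = K \<delta> is so long that \<open>S n x\<close>, at least t - M,
    exceeds 2 D / e, which makes D at most e / 2 per unit of time; the last term forces at least N
    laps.\<close>
  obtain K :: nat where K: "M + 2 * D / e + (real N + 1) * M < real K * \<delta>"
    using reals_Archimedean3[OF \<delta>(1)] by blast
  define t where "t = real K * \<delta>"
  have "0 < t" using K M D e unfolding t_def by (smt (verit) divide_nonneg_pos mult_nonneg_nonneg of_nat_0_le_iff)
  then have K0: "0 < real K" using \<delta>(1) by (simp add: t_def zero_less_mult_iff)
  \<comment> \<open>Of the permitted loss e, a quarter is spent on choosing p, a quarter on
    replacing the sum by an integral, and half on the incomplete laps.\<close>
  have "\<exists>p\<in>Y. real K * (c - e / 4) < (\<Sum>k<K. f (flow (real k * \<delta>) p))"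
  proof (rule ccontr)
    assume "\<not> ?thesis"
    then have le: "(\<Sum>k<K. f (flow (real k * \<delta>) p)) \<le> real K * (c - e / 4)" if "p \<in> Y" for p
      using that by (auto simp: not_less)
    have inv: "flow (real k * \<delta>) \<in> measurable \<nu> \<nu>" "distr \<nu> \<nu> (flow (real k * \<delta>)) = \<nu>" for k
      using \<nu> \<delta>(1) by (auto simp: susp_inv_measures_def)
    have i: "integrable \<nu> (\<lambda>p. f (flow (real k * \<delta>) p))" for k
      using integrable_distr[OF inv(1)[of k], of f] cont_integrable[OF \<nu>P f] by (simp add: inv(2))
    have "integral\<^sup>L \<nu> (\<lambda>p. f (flow (real k * \<delta>) p)) = c" for k
      using integral_distr[OF inv(1)[of k] cont_measurable[OF \<nu>P f]] by (simp add: inv(2) c_def)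
    then have "real K * c = integral\<^sup>L \<nu> (\<lambda>p. \<Sum>k<K. f (flow (real k * \<delta>) p))"
      using i by simp
    also have "\<dots> \<le> integral\<^sup>L \<nu> (\<lambda>p. real K * (c - e / 4))"
      using i le by (intro integral_mono) (auto simp: prob_measuresD[OF \<nu>P])
    also have "\<dots> = real K * (c - e / 4)" by (simp add: prob_space)
    finally show False using K0 e by simp
  qed
  then obtain p where p: "p \<in> Y" and pK: "real K * (c - e / 4) < (\<Sum>k<K. f (flow (real k * \<delta>) p))"
    by blast
  let ?F = "\<lambda>u. f (flow u p)"
  have "\<delta> * (\<Sum>k<K'. ?F (real k * \<delta>) - e / 4) \<le> integral {0..real K' * \<delta>} ?F" for K'
  proof (induction K')
    case (Suc k)
    let ?a = "real k * \<delta>" and ?b = "real (Suc k) * \<delta>"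
    have ab: "0 \<le> ?a" "?a \<le> ?b" "?b - ?a = \<delta>" using \<delta>(1) by (auto simp: algebra_simps)
    have "\<delta> * (?F ?a - e / 4) = integral {?a..?b} (\<lambda>_. ?F ?a - e / 4)"
      using ab by simp
    also have "\<dots> \<le> integral {?a..?b} ?F"
    proof (rule integral_le)
      fix u assume u: "u \<in> {?a..?b}"
      then have eq: "flow u p = flow (u - ?a) (flow ?a p)"
        using flow_add[OF p ab(1), of "u - ?a"] by simp
      have "\<bar>f (flow (u - ?a) (flow ?a p)) - f (flow ?a p)\<bar> < e / 4"
        using u ab by (intro \<delta>(2) flow_in p) auto
      then show "?F ?a - e / 4 \<le> ?F u" unfolding eq by linarith
    qed (use integrable_flow[OF f p ab(1)] in auto)
    finally have "\<delta> * (?F ?a - e / 4) \<le> integral {?a..?b} ?F" .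
    moreover have "integral {0..?a} ?F + integral {?a..?b} ?F = integral {0..?b} ?F"
      using ab by (intro Henstock_Kurzweil_Integration.integral_combine integrable_flow[OF f p]) auto
    ultimately show ?case using Suc by (simp add: distrib_left)
  qed simp
  from this[of K] have "\<delta> * ((\<Sum>k<K. ?F (real k * \<delta>)) - real K * (e / 4)) \<le> integral {0..t} ?F"
    by (simp add: sum_subtractf t_def)
  moreover have "\<delta> * (real K * (c - e / 2)) \<le> \<delta> * ((\<Sum>k<K. ?F (real k * \<delta>)) - real K * (e / 4))"
    using pK \<delta>(1) by (intro mult_left_mono) (auto simp: algebra_simps)
  ultimately have It: "t * (c - e / 2) \<le> integral {0..t} ?F" by (simp add: t_def mult_ac)
  obtain x s where xs: "p = (x, s)" by (cases p)
  have x: "x \<in> X" "0 \<le> s" "s < \<tau> x" using p by (auto simp: xs Y_iff)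
  obtain n where n: "S n x \<le> s + t" "s + t < S (Suc n) x"
    using lap_exists[of x "s + t"] x \<open>0 < t\<close> by auto
  let ?G = "\<lambda>u. f (flow u (x, 0))"
  note bx = base_in[OF x(1)]
  have fs: "flow s (x, 0) = p" using flow_eq[OF x(1), of 0 0 s] x by (simp add: xs roof_sum_Suc)
  have \<tau>n: "\<tau> ((T ^^ n) x) \<le> M" using M(2) x by simp
  have S0: "0 \<le> S n x" using roof_sum_mono[OF x(1), of 0 n] by simp
  have st: "s + t - S n x \<le> M" "s \<le> M" using n \<tau>n M(2)[OF x(1)] x by (auto simp: roof_sum_Suc)
  have "integral {0..t} ?F = integral {0..t} (?G \<circ> (+) s)"
    using flow_add[OF bx x(2)] by (intro integral_cong) (simp add: fs)
  also have "\<dots> = integral {s..t+s} ?G" by (simp add: integral_shift_Icc_real)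
  finally have "integral {0..t} ?F = integral {0..S n x} ?G + integral {S n x..t+s} ?G - integral {0..s} ?G"
    using Henstock_Kurzweil_Integration.integral_combine[of 0 s "t + s" ?G]
      Henstock_Kurzweil_Integration.integral_combine[of 0 "S n x" "t + s" ?G]
      integrable_flow[OF f bx, of 0 "t + s"] x S0 n \<open>0 < t\<close> by simp
  moreover have "\<bar>integral {S n x..t+s} ?G\<bar> \<le> B * M"
  proof -
    have "\<bar>integral {S n x..t+s} ?G\<bar> \<le> B * (t + s - S n x)"
      using n by (intro integral_flow_bound[OF f bx B(2)] S0) auto
    also have "\<dots> \<le> B * M" using st B by (intro mult_left_mono) auto
    finally show ?thesis .
  qed
  moreover have "\<bar>integral {0..s} ?G\<bar> \<le> B * M"
  proof -
    have "\<bar>integral {0..s} ?G\<bar> \<le> B * (s - 0)"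
      using x by (intro integral_flow_bound[OF f bx B(2)]) auto
    also have "\<dots> \<le> B * M" using st B by (intro mult_left_mono) auto
    finally show ?thesis .
  qed
  ultimately have R: "t * (c - e / 2) - 2 * B * M \<le> roof_sum T (hat f) n x"
    using It integral_laps[OF f x(1), of n] by linarith
  have tS: "\<bar>t - S n x\<bar> \<le> M" using n st x by linarith
  then have "\<bar>(t - S n x) * (c - e / 2)\<bar> \<le> M * \<bar>c - e / 2\<bar>"
    by (simp add: abs_mult mult_right_mono)
  then have "S n x * (c - e / 2) - M * \<bar>c - e / 2\<bar> \<le> t * (c - e / 2)"
    by (simp add: left_diff_distrib)
  with R have R': "S n x * (c - e / 2) - D \<le> roof_sum T (hat f) n x" by (simp add: D_def)
  have "2 * D / e \<le> S n x"
  proof -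
    have "0 \<le> (real N + 1) * M" using M by simp
    then show ?thesis using tS K unfolding t_def[symmetric] by linarith
  qed
  then have "D \<le> S n x * (e / 2)" using e by (simp add: field_simps)
  then have fin: "(c - e) * S n x \<le> roof_sum T (hat f) n x" using R' by (simp add: algebra_simps)
  have "S k x \<le> real k * M" for k
  proof (induction k)
    case (Suc k) then show ?case using M(2)[of "(T ^^ k) x"] x by (simp add: roof_sum_Suc algebra_simps)
  qed simp
  from this[of "Suc n"] have "t < real (Suc n) * M" using n x by linarith
  moreover have "0 \<le> 2 * D / e" using D e by simp
  ultimately have "(real N + 1) * M < real (Suc n) * M" using K M(1) unfolding t_def by linarith
  then have "N \<le> n" using M(1) by simp
  then show ?thesis using fin x by (auto simp: c_def)
qed

text \<open>Specification gives a point for the first K segments, for each K. The conditions on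
  segment k hold for all K > k and so pass to the limit of a convergent subsequence, at the price of
  a non-strict inequality.\<close>

lemma infinite_shadowing:
  assumes spec: "has_specification X T" and e: "0 < \<epsilon>"
  shows "\<exists>m>0. \<forall>a n xs. (\<forall>k. xs k \<in> X \<and> 0 < n k \<and> a k + n k + m \<le> a (Suc k)) \<longrightarrow>
    (\<exists>x\<in>X. \<forall>k. \<forall>p<n k. dist ((T ^^ (p + a k)) x) ((T ^^ p) (xs k)) \<le> \<epsilon>)"
proof -
  from spec[unfolded has_specification_def, rule_format, OF e]
  obtain m :: nat where m: "\<forall>k a b xs. (\<forall>j<k. a j \<le> b j \<and> xs j \<in> X) \<and>
      (\<forall>j. Suc j < k \<longrightarrow> b j + m \<le> a (Suc j)) \<longrightarrow>
      (\<exists>x\<in>X. \<forall>j<k. \<forall>p\<le>b j - a j. dist ((T ^^ (p + a j)) x) ((T ^^ p) (xs j)) < \<epsilon>)"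
    by (rule exE)
  show ?thesis
  \<comment> \<open>The gap is enlarged by 1 to be positive; in the gluing this makes the k-th
    starting time at least k.\<close>
  proof (intro exI[of _ "Suc m"] conjI allI impI)
    fix a n and xs :: "nat \<Rightarrow> 'a"
    assume A: "\<forall>k. xs k \<in> X \<and> 0 < n k \<and> a k + n k + Suc m \<le> a (Suc k)"
    have "\<exists>x\<in>X. \<forall>j<K. \<forall>p\<le>(a j + n j) - a j. dist ((T ^^ (p + a j)) x) ((T ^^ p) (xs j)) < \<epsilon>" for K
    proof (rule m[rule_format])
      have "a j + n j + m \<le> a (Suc j)" for j using A[rule_format, of j] by simp
      then show "(\<forall>j<K. a j \<le> a j + n j \<and> xs j \<in> X) \<and> (\<forall>j. Suc j < K \<longrightarrow> a j + n j + m \<le> a (Suc j))"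
        using A by simp
    qed
    then have "\<forall>K. \<exists>x. x \<in> X \<and> (\<forall>j<K. \<forall>p\<le>n j. dist ((T ^^ (p + a j)) x) ((T ^^ p) (xs j)) < \<epsilon>)"
      by (simp add: Bex_def)
    then obtain z where "\<forall>K. z K \<in> X \<and>
        (\<forall>j<K. \<forall>p\<le>n j. dist ((T ^^ (p + a j)) (z K)) ((T ^^ p) (xs j)) < \<epsilon>)"
      by (rule choice[THEN exE])
    then have z: "z K \<in> X"
      "j < K \<Longrightarrow> p \<le> n j \<Longrightarrow> dist ((T ^^ (p + a j)) (z K)) ((T ^^ p) (xs j)) < \<epsilon>" for K j p
      by auto
    obtain x r where x: "x \<in> X" and r: "strict_mono r" "(z \<circ> r) \<longlonglongrightarrow> x"
      using compact[unfolded compact_def, rule_format, of z] z(1) by blast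
    show "\<exists>x\<in>X. \<forall>k. \<forall>p<n k. dist ((T ^^ (p + a k)) x) ((T ^^ p) (xs k)) \<le> \<epsilon>"
    proof (intro bexI[OF _ x] allI impI)
      fix k p assume p: "p < n k"
      have "(\<lambda>i. (T ^^ (p + a k)) ((z \<circ> r) i)) \<longlonglongrightarrow> (T ^^ (p + a k)) x"
        by (rule continuous_on_tendsto_compose[OF continuous_on_funpow r(2) x]) (simp add: z(1))
      then have "(\<lambda>i. dist ((T ^^ (p + a k)) (z (r i))) ((T ^^ p) (xs k)))
          \<longlonglongrightarrow> dist ((T ^^ (p + a k)) x) ((T ^^ p) (xs k))"
        by (intro tendsto_dist) (auto simp: comp_def)
      moreover have "dist ((T ^^ (p + a k)) (z (r i))) ((T ^^ p) (xs k)) \<le> \<epsilon>" if "Suc k \<le> i" for i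
        using z(2)[of k "r i" p] p that seq_suble[OF r(1), of i] by simp
      ultimately show "dist ((T ^^ (p + a k)) x) ((T ^^ p) (xs k)) \<le> \<epsilon>"
        by (intro LIMSEQ_le_const2 exI[of _ "Suc k"]) auto
    qed
  qed simp
qed

text \<open>Segments realising the J requirements in turn are glued together, each one so long that
  everything before it is negligible.\<close>
lemma glue_segments:
  fixes w :: "nat \<Rightarrow> 'a \<Rightarrow> real"
  assumes spec: "has_specification X T" and J: "0 < J"
    and w: "\<And>j. j < J \<Longrightarrow> continuous_on X (w j)"
    and seg: "\<And>j N. j < J \<Longrightarrow> \<exists>n\<ge>N. \<exists>x\<in>X. 0 \<le> roof_sum T (w j) n x"
    and e: "0 < \<eta>"
  shows "\<exists>x\<in>X. \<forall>j<J. \<forall>N. \<exists>n\<ge>N. - \<eta> * real n \<le> roof_sum T (w j) n x"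
proof -
  have "\<exists>B. \<forall>x\<in>X. \<bar>w j x\<bar> \<le> B" if "j < J" for j
    using compact_imp_bounded[OF compact_continuous_image[OF w[OF that] compact]]
    by (auto simp: bounded_iff)
  then obtain b where b: "\<And>j x. j < J \<Longrightarrow> x \<in> X \<Longrightarrow> \<bar>w j x\<bar> \<le> b j" by metis
  define B where "B = (\<Sum>j<J. \<bar>b j\<bar>)"
  have B: "\<bar>w j x\<bar> \<le> B" if "j < J" "x \<in> X" for j x
  proof -
    have "\<bar>b j\<bar> \<le> B" unfolding B_def using that by (intro member_le_sum) auto
    then show ?thesis using b[OF that] by linarith
  qed
  have "\<exists>d>0. \<forall>x\<in>X. \<forall>y\<in>X. dist y x < d \<longrightarrow> \<bar>w j y - w j x\<bar> < \<eta> / 2" if "j < J" for j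
    using compact_uniformly_continuous[OF w[OF that] compact] e
    unfolding uniformly_continuous_on_def dist_real_def by (metis half_gt_zero)
  then obtain d where d: "\<And>j. j < J \<Longrightarrow> 0 < d j"
    "\<And>j x y. j < J \<Longrightarrow> x \<in> X \<Longrightarrow> y \<in> X \<Longrightarrow> dist y x < d j \<Longrightarrow> \<bar>w j y - w j x\<bar> < \<eta> / 2" by metis
  \<comment> \<open>Halving puts \<epsilon> strictly below every \<open>d j\<close>, since the
    shadowing inequality is not strict.\<close>
  define \<epsilon> where "\<epsilon> = Min (d ` {..<J}) / 2"
  have "0 < Min (d ` {..<J})" using d(1) J by (subst Min_gr_iff) auto
  then have \<epsilon>: "0 < \<epsilon>" "2 * \<epsilon> = Min (d ` {..<J})" by (auto simp: \<epsilon>_def)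
  have \<epsilon>d: "\<epsilon> < d j" if "j < J" for j
  proof -
    have "Min (d ` {..<J}) \<le> d j" using that by simp
    then show ?thesis using \<epsilon> by linarith
  qed
  obtain m where m: "0 < m" and shadow: "\<forall>a n xs. (\<forall>k. xs k \<in> X \<and> 0 < n k \<and> a k + n k + m \<le> a (Suc k)) \<longrightarrow>
    (\<exists>x\<in>X. \<forall>k. \<forall>p<n k. dist ((T ^^ (p + a k)) x) ((T ^^ p) (xs k)) \<le> \<epsilon>)"
    using infinite_shadowing[OF spec \<epsilon>(1)] by (elim exE conjE) (rule that)
  define good where "good k N z \<longleftrightarrow> N \<le> fst z \<and> snd z \<in> X \<and> 0 \<le> roof_sum T (w (k mod J)) (fst z) (snd z)"
    for k N z
  define len where "len k N = fst (SOME z. good k N z)" for k N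
  define pt where "pt k N = snd (SOME z. good k N z)" for k N
  have "\<exists>z. good k N z" for k N
    using seg[of "k mod J" N] J by (auto simp: good_def)
  from someI_ex[OF this] have lp: "N \<le> len k N" "pt k N \<in> X"
    "0 \<le> roof_sum T (w (k mod J)) (len k N) (pt k N)" for k N
    by (auto simp: good_def len_def pt_def)
  \<comment> \<open>A segment of length at least 2 B a / \<eta> absorbs the preceding a steps, whose
    sum is at least -B a, at a cost of \<eta> / 2 per step; \<open>Suc\<close> keeps the length
    positive.\<close>
  define big where "big a = Suc (nat \<lceil>2 * B * real a / \<eta>\<rceil>)" for a
  \<comment> \<open>The start of a segment determines its required length and thereby the next
    start, so the starts are defined by recursion and the lengths and points read off from
    them.\<close>
  define a where "a = rec_nat 0 (\<lambda>k ak. ak + len k (big ak) + m)"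
  define n where "n k = len k (big (a k))" for k
  define xs where "xs k = pt k (big (a k))" for k
  have aS: "a (Suc k) = a k + n k + m" for k by (simp add: a_def n_def)
  have ak: "k \<le> a k" for k
    by (induction k) (use m in \<open>auto simp: aS\<close>)
  have nb: "big (a k) \<le> n k" for k by (simp add: n_def lp)
  have "\<forall>k. xs k \<in> X \<and> 0 < n k \<and> a k + n k + m \<le> a (Suc k)"
    using nb by (auto simp: xs_def lp aS big_def Suc_le_eq intro: le_less_trans)
  then obtain x where x: "x \<in> X" "\<And>k p. p < n k \<Longrightarrow> dist ((T ^^ (p + a k)) x) ((T ^^ p) (xs k)) \<le> \<epsilon>"
    using shadow[rule_format, of xs n a] by blast
  have lower: "- \<eta> * real (a k + n k) \<le> roof_sum T (w (k mod J)) (a k + n k) x" for k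
  proof -
    define j where "j = k mod J"
    have j: "j < J" using J by (simp add: j_def)
    have "- B * real (a k) \<le> roof_sum T (w j) (a k) x"
    proof -
      have "(\<Sum>i<a k. - B) \<le> roof_sum T (w j) (a k) x"
        unfolding roof_sum_def using B[OF j funpow_in[OF x(1)]] by (intro sum_mono) (simp add: abs_le_iff minus_le_iff)
      then show ?thesis by (simp add: mult.commute)
    qed
    moreover have "- (\<eta> / 2) * real (n k) \<le> roof_sum T (w j) (n k) ((T ^^ a k) x)"
    proof -
      have "(\<Sum>p<n k. w j ((T ^^ p) (xs k)) - \<eta> / 2) \<le> roof_sum T (w j) (n k) ((T ^^ a k) x)"
        unfolding roof_sum_def
      proof (rule sum_mono)
        fix p assume "p \<in> {..<n k}"
        then have "dist ((T ^^ (p + a k)) x) ((T ^^ p) (xs k)) < d j"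
          using x(2)[of p k] \<epsilon>d[OF j] by simp
        then have "\<bar>w j ((T ^^ (p + a k)) x) - w j ((T ^^ p) (xs k))\<bar> < \<eta> / 2"
          using x(1) lp(2) by (intro d(2)[OF j]) (auto simp: xs_def)
        then show "w j ((T ^^ p) (xs k)) - \<eta> / 2 \<le> w j ((T ^^ p) ((T ^^ a k) x))"
          unfolding funpow_add comp_apply by linarith
      qed
      moreover have "0 \<le> (\<Sum>p<n k. w j ((T ^^ p) (xs k)))"
        using lp(3)[of k "big (a k)"] by (simp add: roof_sum_def n_def xs_def j_def)
      ultimately show ?thesis by (simp add: sum_subtractf mult.commute)
    qed
    moreover have "B * real (a k) \<le> \<eta> / 2 * real (n k)"
    proof -
      have "2 * B * real (a k) / \<eta> \<le> real (big (a k))" unfolding big_def by linarith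
      also have "\<dots> \<le> real (n k)" using nb by simp
      finally show ?thesis using e by (simp add: field_simps)
    qed
    moreover have "0 \<le> \<eta> * real (a k)" using e by simp
    ultimately show ?thesis
      unfolding roof_sum_add j_def[symmetric] by (simp add: algebra_simps)
  qed
  show ?thesis
  proof (intro bexI[OF _ x(1)] allI impI)
    fix j N assume j: "j < J"
    \<comment> \<open>The remainder modulo J selects requirement j, and the multiple of J makes the
      segment end no earlier than N.\<close>
    define k where "k = N * J + j"
    have "k mod J = j" using j by (simp add: k_def)
    moreover have "N \<le> a k + n k"
    proof -
      have "N \<le> N * J" using J by simp
      then show ?thesis using ak[of k] unfolding k_def by linarith
    qed
    ultimately show "\<exists>n\<ge>N. - \<eta> * real n \<le> roof_sum T (w j) n x" using lower[of k] by auto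
  qed
qed

text \<open>Three requirements are met in turn: large averages of H as for
  \<open>\<nu>\<^sub>0\<close>, of \<Phi> as for \<open>\<nu>\<^sub>1\<close>, and of -\<Phi> as for
  \<open>\<nu>\<^sub>2\<close>. The last two exclude a limit of the averages of \<Phi>.\<close>

lemma exists_irregular:
  assumes spec: "has_specification X T" and \<Phi>: "cont_real \<Phi>" and H: "cont_real H"
    and \<nu>: "\<nu>\<^sub>0 \<in> susp_inv_measures X T \<tau>" "\<nu>\<^sub>1 \<in> susp_inv_measures X T \<tau>" "\<nu>\<^sub>2 \<in> susp_inv_measures X T \<tau>"
    and lt: "integral\<^sup>L \<nu>\<^sub>2 \<Phi> < integral\<^sup>L \<nu>\<^sub>1 \<Phi>" and e: "0 < e"
  shows "\<exists>p\<in>susp_irregular X T \<tau> \<Phi>. frequently (\<lambda>t. integral\<^sup>L \<nu>\<^sub>0 H - e \<le> avg H p t) at_top"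
proof -
  \<comment> \<open>Each requirement is met with loss 2 \<eta>. For H this is at most e; for \<Phi>
    a limit would force the gap between the two integrals to be at most 4 \<eta>, whereas it is at
    least 6 \<eta>.\<close>
  define \<eta> where "\<eta> = min e ((integral\<^sup>L \<nu>\<^sub>1 \<Phi> - integral\<^sup>L \<nu>\<^sub>2 \<Phi>) / 3) / 2"
  have \<eta>: "0 < \<eta>" "2 * \<eta> \<le> e" "6 * \<eta> \<le> integral\<^sup>L \<nu>\<^sub>1 \<Phi> - integral\<^sup>L \<nu>\<^sub>2 \<Phi>"
    using e lt by (auto simp: \<eta>_def min_def)
  define F where "F j = (if j = 0 then H else if j = 1 then \<Phi> else (\<lambda>p. - \<Phi> p))" for j :: nat
  define \<mu> where "\<mu> j = (if j = 0 then \<nu>\<^sub>0 else if j = 1 then \<nu>\<^sub>1 else \<nu>\<^sub>2)" for j :: nat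
  define c where "c j = integral\<^sup>L (\<mu> j) (F j)" for j
  have F: "cont_real (F j)" for j using \<Phi> H by (simp add: F_def continuous_map_minus)
  have \<mu>: "\<mu> j \<in> susp_inv_measures X T \<tau>" for j using \<nu> by (simp add: \<mu>_def)
  \<comment> \<open>A nonnegative sum of \<open>w j\<close> over n laps says that \<open>F j\<close>
    averages at least c j - \<eta>. The elapsed time enters as a summand and not as a divisor, which
    makes the condition additive along the orbit.\<close>
  define w where "w j x = hat (F j) x - (c j - \<eta>) * \<tau> x" for j x
  have sw: "roof_sum T (w j) n x = roof_sum T (hat (F j)) n x - (c j - \<eta>) * S n x" for j n x
    by (simp add: roof_sum_def w_def sum_subtractf sum_distrib_left)
  \<comment> \<open>The tolerance contains \<open>roof_min\<close> because \<open>S n x\<close> is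
    at least \<open>roof_min * real n\<close>: the error per step becomes an error of at most \<eta>
    per unit of flow time.\<close>
  have "\<exists>x\<in>X. \<forall>j<3. \<forall>N. \<exists>n\<ge>N. - (\<eta> * roof_min) * real n \<le> roof_sum T (w j) n x"
  proof (rule glue_segments[OF spec])
    show "continuous_on X (w j)" for j
      unfolding w_def by (intro continuous_intros continuous_on_hat F cont_roof)
    show "\<exists>n\<ge>N. \<exists>x\<in>X. 0 \<le> roof_sum T (w j) n x" for j N
      using orbit_segment[OF \<mu> F \<eta>(1), of N j j] by (simp add: sw c_def)
  qed (use \<eta> roof_min in auto)
  then obtain x where x: "x \<in> X"
    and lower: "\<And>j N. j < 3 \<Longrightarrow> \<exists>n\<ge>N. - (\<eta> * roof_min) * real n \<le> roof_sum T (w j) n x" by blast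
  have fr: "frequently (\<lambda>t. c j - 2 * \<eta> \<le> avg (F j) (x, 0) t) at_top" if j: "j < 3" for j
    unfolding frequently_def eventually_at_top_linorder
  proof
    assume "\<exists>t0. \<forall>t\<ge>t0. \<not> c j - 2 * \<eta> \<le> avg (F j) (x, 0) t"
    then obtain t0 where t0: "\<And>t. t0 \<le> t \<Longrightarrow> avg (F j) (x, 0) t < c j - 2 * \<eta>" by (auto simp: not_le)
    obtain N where N: "t0 < real N * roof_min" using reals_Archimedean3[OF roof_min(1)] by blast
    obtain n where n: "n \<ge> Suc N" "- (\<eta> * roof_min) * real n \<le> roof_sum T (w j) n x"
      using lower[OF j] by blast
    have Sn: "roof_min * real n \<le> S n x" by (rule roof_sum_ge[OF x])
    have "real N * roof_min \<le> roof_min * real n" using n(1) roof_min(1) by (simp add: mult.commute)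
    then have "t0 \<le> S n x" using N Sn by linarith
    moreover have "0 < S n x"
    proof -
      have "0 < roof_min * real n" using n(1) roof_min(1) by simp
      then show ?thesis using Sn by linarith
    qed
    moreover have "\<eta> * (roof_min * real n) \<le> \<eta> * S n x" using Sn \<eta>(1) by (intro mult_left_mono) auto
    then have "(c j - 2 * \<eta>) * S n x \<le> roof_sum T (hat (F j)) n x"
      using n(2) by (simp add: sw algebra_simps)
    ultimately show False using t0[of "S n x"] avg_laps[OF F x, of j n] by (simp add: pos_divide_less_eq)
  qed
  have neg: "avg (\<lambda>p. - \<Phi> p) p t = - avg \<Phi> p t" for p t by (simp add: susp_avg_def)
  have no: "\<not> (avg \<Phi> (x, 0) \<longlongrightarrow> l) at_top" for l
  proof
    assume lim: "(avg \<Phi> (x, 0) \<longlongrightarrow> l) at_top"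
    have "integral\<^sup>L \<nu>\<^sub>1 \<Phi> - 2 * \<eta> \<le> l"
    proof (rule ccontr)
      assume "\<not> ?thesis"
      then have "eventually (\<lambda>t. avg \<Phi> (x, 0) t < integral\<^sup>L \<nu>\<^sub>1 \<Phi> - 2 * \<eta>) at_top"
        using order_tendstoD(2)[OF lim] by simp
      then show False using fr[of 1] by (simp add: frequently_def F_def \<mu>_def c_def not_le)
    qed
    moreover have "l \<le> integral\<^sup>L \<nu>\<^sub>2 \<Phi> + 2 * \<eta>"
    proof (rule ccontr)
      assume "\<not> ?thesis"
      then have "eventually (\<lambda>t. integral\<^sup>L \<nu>\<^sub>2 \<Phi> + 2 * \<eta> < avg \<Phi> (x, 0) t) at_top"
        using order_tendstoD(1)[OF lim] by simp
      then have "eventually (\<lambda>t. \<not> - integral\<^sup>L \<nu>\<^sub>2 \<Phi> - 2 * \<eta> \<le> - avg \<Phi> (x, 0) t) at_top"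
        by eventually_elim linarith
      then show False using fr[of 2] by (simp add: frequently_def F_def \<mu>_def c_def neg)
    qed
    ultimately show False using \<eta> by linarith
  qed
  have "frequently (\<lambda>t. integral\<^sup>L \<nu>\<^sub>0 H - e \<le> avg H (x, 0) t) at_top"
    using fr[of 0] \<eta>(2) by (auto simp: F_def \<mu>_def c_def elim!: frequently_elim1)
  then show ?thesis using no base_in[OF x] by (intro bexI[of _ "(x, 0)"]) (auto simp: susp_irregular_def)
qed

end

section \<open>The cycle of inequalities between the three suprema\<close>

theorem theorem5p2:
  fixes X :: "'a::metric_space set"
    and T :: "'a \<Rightarrow> 'a"
    and \<tau> :: "'a \<Rightarrow> real"
    and \<Phi> H :: "'a \<times> real \<Rightarrow> real"
  assumes "compact X"
    and "\<exists>g. homeomorphism X X T g"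
    and "has_specification X T"
    and "continuous_on X \<tau>"
    and "\<forall>x\<in>X. 0 < \<tau> x"
    and "continuous_map (susp_top X T \<tau>) euclideanreal \<Phi>"
    and "continuous_map (susp_top X T \<tau>) euclideanreal H"
    and "(INF \<nu>\<in>susp_inv_measures X T \<tau>. ereal (integral\<^sup>L \<nu> \<Phi>))
           < (SUP \<nu>\<in>susp_inv_measures X T \<tau>. ereal (integral\<^sup>L \<nu> \<Phi>))"
  shows "(SUP \<nu>\<in>susp_inv_measures X T \<tau>. ereal (integral\<^sup>L \<nu> H))
           = (SUP \<nu>\<in>(\<Union>p\<in>susp_irregular X T \<tau> \<Phi>. susp_V X T \<tau> p). ereal (integral\<^sup>L \<nu> H))
       \<and> (SUP \<nu>\<in>(\<Union>p\<in>susp_irregular X T \<tau> \<Phi>. susp_V X T \<tau> p). ereal (integral\<^sup>L \<nu> H))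
           = (SUP p\<in>susp_irregular X T \<tau> \<Phi>. Limsup at_top (\<lambda>t. ereal (susp_avg T \<tau> H p t)))"
    (is "?inv = ?V \<and> ?V = ?lim")
proof -
  obtain g where "homeomorphism X X T g" using assms(2) by blast
  then interpret suspension X T g \<tau> using assms(1,4,5) by unfold_locales auto
  note H = assms(7)
  obtain \<nu>\<^sub>1 \<nu>\<^sub>2 where \<nu>: "\<nu>\<^sub>1 \<in> susp_inv_measures X T \<tau>" "\<nu>\<^sub>2 \<in> susp_inv_measures X T \<tau>"
    and lt: "integral\<^sup>L \<nu>\<^sub>2 \<Phi> < integral\<^sup>L \<nu>\<^sub>1 \<Phi>"
    using assms(8) unfolding less_SUP_iff INF_less_iff less_ereal.simps by blast
  have irrY: "p \<in> susp_irregular X T \<tau> \<Phi> \<Longrightarrow> p \<in> Y" for p by (simp add: susp_irregular_def)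
  have "ereal (integral\<^sup>L \<nu>\<^sub>0 H) \<le> ?lim" if \<nu>0: "\<nu>\<^sub>0 \<in> susp_inv_measures X T \<tau>" for \<nu>\<^sub>0
  proof (rule ereal_le_epsilon2)
    fix e :: real assume e: "0 < e"
    obtain p where p: "p \<in> susp_irregular X T \<tau> \<Phi>"
      and fr: "frequently (\<lambda>t. integral\<^sup>L \<nu>\<^sub>0 H - e \<le> avg H p t) at_top"
      using exists_irregular[OF assms(3,6) H \<nu>0 \<nu> lt e] by blast
    have "ereal (integral\<^sup>L \<nu>\<^sub>0 H - e) \<le> Limsup at_top (\<lambda>t. ereal (avg H p t))"
    proof (rule ccontr)
      assume "\<not> ?thesis"
      then have "eventually (\<lambda>t. ereal (avg H p t) < ereal (integral\<^sup>L \<nu>\<^sub>0 H - e)) at_top"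
        by (intro Limsup_lessD) (simp add: not_le)
      then show False using fr by (simp add: frequently_def not_le)
    qed
    also have "\<dots> \<le> ?lim" by (rule SUP_upper[OF p])
    finally have "ereal (integral\<^sup>L \<nu>\<^sub>0 H - e) + ereal e \<le> ?lim + ereal e" by (rule add_right_mono)
    then show "ereal (integral\<^sup>L \<nu>\<^sub>0 H) \<le> ?lim + ereal e" by simp
  qed
  then have "?inv \<le> ?lim" by (rule SUP_least)
  moreover have "Limsup at_top (\<lambda>t. ereal (avg H p t)) \<le> ?V" if p: "p \<in> susp_irregular X T \<tau> \<Phi>" for p
  \<comment> \<open>The limsup itself need not be exceeded, but every real number strictly below it
    is exceeded at arbitrarily large times, which is what \<open>V_exists\<close> asks for.\<close>
  proof (rule dense_le)
    fix r assume r: "r < Limsup at_top (\<lambda>t. ereal (avg H p t))"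
    show "r \<le> ?V"
    proof (cases r)
      case (real r')
      have "frequently (\<lambda>t. r' < avg H p t) at_top"
      proof (rule ccontr)
        assume "\<not> ?thesis"
        then have "eventually (\<lambda>t. ereal (avg H p t) \<le> r) at_top"
          by (simp add: frequently_def real not_less)
        then show False using Limsup_bounded[of "\<lambda>t. ereal (avg H p t)" r at_top] r by simp
      qed
      then obtain \<nu> where \<nu>V: "\<nu> \<in> susp_V X T \<tau> p" "r' \<le> integral\<^sup>L \<nu> H"
        by (rule V_exists[OF irrY[OF p] H])
      have "r \<le> ereal (integral\<^sup>L \<nu> H)" using \<nu>V by (simp add: real)
      also have "\<dots> \<le> ?V" using p \<nu>V(1) by (intro SUP_upper) blast
      finally show ?thesis .
    qed (use r in auto)
  qed
  then have "?lim \<le> ?V" by (rule SUP_least)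
  moreover have "?V \<le> ?inv"
    using V_invariant[OF irrY] by (intro SUP_subset_mono UN_least subsetI) auto
  ultimately show ?thesis by auto
qed

end
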